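(* Consider a deterministic walk in a deterministic environment (DWDE) on $\mathbb{Z}$ as in the context. Suppose that the DWDE satisfies the Linkage Property, has uniformly bounded jumps, and has an ergodic and stationary environment. If the DWDE is transient, then one of the following two cases holds: (i) $\lim_{n\to\infty}U_{i,n}(x,\omega)=+\infty$ for all $i\in\mathbb{Z}$, for $P$-a.e. $\omega\in\Omega$ and for $m$-a.e. $x\in X$; or (ii) $\lim_{n\to\infty}U_{i,n}(x,\omega)=-\infty$ for all $i\in\mathbb{Z}$, for $P$-a.e. $\omega\in\Omega$ and for $m$-a.e. $x\in X$.
   Context: Base map. A non-singular transformation $T$ of a measure space $(X,m)$ is Markov with (countable) measurable Markov partition $\beta$ of $X$ if for every $a\in\beta$, $T(a)$ is a union of elements of $\beta$ and $T|_a:a\to T(a)$ is a bijection. $n$-cylinders (cylinders of rank $n$) are the sets $[a_0,\dots,a_{n-1}]:=\bigcap_{j=0}^{n-1}T^{-j}a_j$ with $a_j\in\beta$; $\beta_n$ is the collection of all $n$-cylinders; $|a|$ is the rank of a cylinder $a$; a cylinder is admissible if it has positive measure. For $a\in\beta_n$ let $v'_a$ be the Radon-Nikodym derivative with $\int_{T^na\cap B}v'_a\,dm=m(a\cap T^{-n}B)$ for every measurable $B$. $T$ has the Strong Distortion Property if there is $D\ge1$ such that for all $n\ge1$, $a\in\beta_n$ and a.e. $x,y\in T^na$, $v'_a(x)/v'_a(y)\le D$. $T$ has the Big Image Property if $\inf_{a\in\beta}m(Ta)>0$. Standing assumptions: $T$ is a Markov transformation of a probability space $(X,m)$ with Markov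 partition $\beta$, having the Strong Distortion and Big Image Properties, and $\beta$ separates points (for all $x\ne y$ in $X$ there are $n\ge1$ and $a,b\in\beta_n$ with $a\cap b=\emptyset$, $x\in a$, $y\in b$). Environment. $G$ is a set of functions $g:X\to\mathbb{Z}$ constant on elements of $\beta$. $\eta:\Omega\to\Omega$ is an invertible measurable transformation of a probability space $(\Omega,P)$ and $\phi:\Omega\to G$ is measurable, where $G$ carries the Borel $\sigma$-algebra of the following topology: discrete if $\beta$ is finite; if $\beta=\{a_n\}_{n\ge1}$ is infinite, the topology of the metric $d(f,g)=(1/2)^{S(f,g)}$, $S(f,g)=\max\{n\ge0:f(a_j)=g(a_j)\text{ for }1\le j\le n\}$ ($d(f,f)=0$). Each $\omega$ encodes the environment $(f_i)_{i\in\mathbb{Z}}$, $f_i:=\phi(\eta^i\omega)$. The environment is ergodic and stationary if $\eta$ preserves $P$ and is ergodic. DWDE. The skew-product is $T_f=T_{f(\omega)}:(x,i)\mapsto(Tx,i+f_i(x))$ on $X\times\mathbb{Z}$; the DWDE is $U_{i,n}(x,\omega):=\pi_2(T^n_{f(\omega)}(x,i))$, where $\pi_2(x,y)=y$. Put $\mu:=m\times$ counting measure and $\tilde\beta:=\beta\times\mathbb{Z}$ (partition into sets $a\times\{i\}$; for such a set $\pi_2(a\times\{i\}):=i$). Cylinders of $T_f$ are taken with respect to $\tilde\beta$, and measured with $\mu$. For fixed $\omega$, $a\in\tilde\beta$ communicates with $b\in\tilde\beta$ if $\mu(\{z\in a:T_f^nz\in b\text{ for some }n\ge1\})>0$; $\tilde\beta$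 is irreducible under $T_f$ if every two elements communicate with each other. The DWDE is irreducible if this holds for $P$-a.e. $\omega$. For cylinders $v_1,\dots,v_k$ of $T_f$, $v_1\cdot v_2\cdots v_k:=v_1\cap T_f^{-|v_1|}(v_2\cap T_f^{-|v_2|}(\dots(T_f^{-|v_{k-1}|}(v_k))\dots))$. The DWDE has the Linkage Property if it is irreducible and there is $r>0$ such that for almost every environment and all $a,b\in\tilde\beta$ with $|\pi_2(a)-\pi_2(b)|=1$, either $b\subset T_f(a)$, or there is a cylinder $c$ with $\mu(c)\ge r$ and $a\cdot c\cdot b$ admissible. The DWDE has uniformly bounded jumps if there is a finite set $J\subset\mathbb{Z}$ with $g(X)\subset J$ for all $g\in G$. For fixed $\omega$, a state $i$ is recurrent if $m(\{x:U_{i,n}(x,\omega)=i\text{ for some }n\ge1\})=1$, and transient otherwise. The DWDE is transient if for $P$-a.e. $\omega$ every state is transient. *)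

theory Defs
  imports "HOL-Probability.Probability"
begin

section \<open>Markov transformations\<close>

text \<open>
  The cylinders of rank \<open>n\<close> of a map \<open>F\<close> with respect to a partition \<open>\<alpha>\<close>; only ranks \<open>n \<ge> 1\<close>
  are ever used (for \<open>n = 0\<close> the intersection would be the whole type). The same set may be a
  cylinder of several ranks, so the rank is always carried along explicitly.
\<close>
definition cylinders :: "('z \<Rightarrow> 'z) \<Rightarrow> 'z set set \<Rightarrow> nat \<Rightarrow> 'z set set" where
  "cylinders F \<alpha> n = {(\<Inter>j<n. (F ^^ j) -` a j) | a. \<forall>j<n. a j \<in> \<alpha>}"

definition nonsingular_on :: "'a measure \<Rightarrow> ('a \<Rightarrow> 'a) \<Rightarrow> bool" where
  "nonsingular_on M T \<longleftrightarrow> T \<in> M \<rightarrow>\<^sub>M M \<and>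
     (\<forall>A\<in>sets M. emeasure M (T -` A \<inter> space M) = 0 \<longleftrightarrow> emeasure M A = 0)"

definition markov_partition :: "'a measure \<Rightarrow> ('a \<Rightarrow> 'a) \<Rightarrow> 'a set set \<Rightarrow> bool" where
  "markov_partition M T \<beta> \<longleftrightarrow> countable \<beta> \<and> \<beta> \<subseteq> sets M \<and> partition_on (space M) \<beta> \<and>
     (\<forall>a\<in>\<beta>. (\<exists>S\<subseteq>\<beta>. T ` a = \<Union>S) \<and> bij_betw T a (T ` a))"

text \<open>
  The derivative \<open>v'\<^sub>a\<close> of a cylinder \<open>a\<close> of rank \<open>n\<close>: the Radon-Nikodym derivative with respect
  to \<open>M\<close> of the measure sending \<open>B\<close> to \<open>M (a \<inter> T\<^sup>-\<^sup>n B)\<close>. See the lemma \<open>set_nn_integral_cyl_deriv\<close>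
  for its defining equation.
\<close>
definition cyl_deriv :: "'a measure \<Rightarrow> ('a \<Rightarrow> 'a) \<Rightarrow> nat \<Rightarrow> 'a set \<Rightarrow> 'a \<Rightarrow> ennreal" where
  "cyl_deriv M T n a = RN_deriv M (distr (density M (indicator a)) M (T ^^ n))"

text \<open>
  The quotient bound \<open>v'\<^sub>a x / v'\<^sub>a y \<le> D\<close> is written multiplicatively, so that a vanishing
  denominator is not an exception (a quotient by \<open>0\<close> would have to count as infinite).
\<close>
definition strong_distortion :: "'a measure \<Rightarrow> ('a \<Rightarrow> 'a) \<Rightarrow> 'a set set \<Rightarrow> bool" where
  "strong_distortion M T \<beta> \<longleftrightarrow> (\<exists>D::real. D \<ge> 1 \<and>
     (\<forall>n\<ge>1. \<forall>a\<in>cylinders T \<beta> n. AE x in M. AE y in M.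
        x \<in> (T ^^ n) ` a \<longrightarrow> y \<in> (T ^^ n) ` a \<longrightarrow>
        cyl_deriv M T n a x \<le> ennreal D * cyl_deriv M T n a y))"

definition big_image :: "'a measure \<Rightarrow> ('a \<Rightarrow> 'a) \<Rightarrow> 'a set set \<Rightarrow> bool" where
  "big_image M T \<beta> \<longleftrightarrow> (INF a\<in>\<beta>. measure M (T ` a)) > 0"

definition separates_points :: "'a measure \<Rightarrow> ('a \<Rightarrow> 'a) \<Rightarrow> 'a set set \<Rightarrow> bool" where
  "separates_points M T \<beta> \<longleftrightarrow> (\<forall>x\<in>space M. \<forall>y\<in>space M. x \<noteq> y \<longrightarrow>
     (\<exists>n\<ge>1. \<exists>a\<in>cylinders T \<beta> n. \<exists>b\<in>cylinders T \<beta> n. a \<inter> b = {} \<and> x \<in> a \<and> y \<in> b))"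

locale base_map = prob_space M
  for M :: "'a measure" and T :: "'a \<Rightarrow> 'a" and \<beta> :: "'a set set" +
  assumes nonsingular: "nonsingular_on M T"
    and markov: "markov_partition M T \<beta>"
    and strong_distortion: "strong_distortion M T \<beta>"
    and big_image: "big_image M T \<beta>"
    and separates_points: "separates_points M T \<beta>"

lemma (in base_map) set_nn_integral_cyl_deriv:
  assumes a: "a \<in> sets M" and im: "(T ^^ n) ` a \<in> sets M" and B: "B \<in> sets M"
  shows "(\<integral>\<^sup>+x\<in>(T ^^ n) ` a \<inter> B. cyl_deriv M T n a x \<partial>M) = emeasure M (a \<inter> (T ^^ n) -` B)"
proof -
  have T: "T \<in> M \<rightarrow>\<^sub>M M"
    using nonsingular by (simp add: nonsingular_on_def)
  have Tn: "(T ^^ k) \<in> M \<rightarrow>\<^sub>M M" for k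
    using T by (rule measurable_compose_n)
  define N where "N = distr (density M (indicator a)) M (T ^^ n)"
  have sub: "a \<subseteq> space M" using a by (rule sets.sets_into_space)
  have N: "emeasure N C = emeasure M (a \<inter> (T ^^ n) -` C)" if C: "C \<in> sets M" for C
  proof -
    have m: "(T ^^ n) -` C \<inter> space M \<in> sets M" using Tn C by (rule measurable_sets)
    have "emeasure N C = emeasure (density M (indicator a)) ((T ^^ n) -` C \<inter> space M)"
      unfolding N_def using Tn C by (subst emeasure_distr) auto
    also have "\<dots> = emeasure M (a \<inter> ((T ^^ n) -` C \<inter> space M))"
      using a m by (rule emeasure_restricted)
    also have "a \<inter> ((T ^^ n) -` C \<inter> space M) = a \<inter> (T ^^ n) -` C" using sub by blast
    finally show ?thesis .
  qed
  have null: "emeasure M ((T ^^ k) -` C \<inter> space M) = 0"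
    if "C \<in> sets M" "emeasure M C = 0" for k C
    using that
  proof (induction k arbitrary: C)
    case 0
    then show ?case by (simp add: Int_absorb2 sets.sets_into_space)
  next
    case (Suc k)
    have "emeasure M (T -` C \<inter> space M) = 0" "T -` C \<inter> space M \<in> sets M"
      using Suc.prems nonsingular T by (auto simp: nonsingular_on_def)
    then have "emeasure M ((T ^^ k) -` (T -` C \<inter> space M) \<inter> space M) = 0" by (rule Suc.IH[rotated])
    moreover have "(T ^^ k) -` (T -` C \<inter> space M) \<inter> space M = (T ^^ Suc k) -` C \<inter> space M"
      using measurable_space[OF Tn] by auto
    ultimately show ?case by metis
  qed
  have "absolutely_continuous M N"
    unfolding absolutely_continuous_def
  proof
    fix C assume "C \<in> null_sets M"
    then have C: "C \<in> sets M" "emeasure M C = 0" by auto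
    have "emeasure M (a \<inter> (T ^^ n) -` C) \<le> emeasure M ((T ^^ n) -` C \<inter> space M)"
      using sub Tn C by (intro emeasure_mono) auto
    then have "emeasure N C = 0" using N null C by simp
    then show "C \<in> null_sets N" using C by (auto simp: null_sets_def N_def)
  qed
  then have "density M (RN_deriv M N) = N"
    by (rule density_RN_deriv) (simp add: N_def)
  then have "emeasure N ((T ^^ n) ` a \<inter> B) = (\<integral>\<^sup>+x\<in>(T ^^ n) ` a \<inter> B. RN_deriv M N x \<partial>M)"
    using emeasure_density[OF borel_measurable_RN_deriv sets.Int[OF im B], of N] by simp
  moreover have "a \<inter> (T ^^ n) -` ((T ^^ n) ` a \<inter> B) = a \<inter> (T ^^ n) -` B" by blast
  ultimately show ?thesis using N im B by (simp add: cyl_deriv_def N_def)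
qed


section \<open>The environment\<close>

text \<open>
  The enumeration \<open>e 1, e 2, \<dots>\<close> of the (infinite) partition starts at index \<open>1\<close>. All functions in
  question are constant on each \<open>e j\<close>, so agreeing on \<open>e j\<close> means having the same value there.
\<close>
definition agreement :: "(nat \<Rightarrow> 'a set) \<Rightarrow> ('a \<Rightarrow> int) \<Rightarrow> ('a \<Rightarrow> int) \<Rightarrow> nat" where
  "agreement e f g = Max {n. \<forall>j\<in>{1..n}. \<forall>x\<in>e j. f x = g x}"

definition step_dist :: "(nat \<Rightarrow> 'a set) \<Rightarrow> ('a \<Rightarrow> int) \<Rightarrow> ('a \<Rightarrow> int) \<Rightarrow> real" where
  "step_dist e f g = (if f = g then 0 else (1/2) ^ agreement e f g)"

definition step_topology ::
    "'a set set \<Rightarrow> (nat \<Rightarrow> 'a set) \<Rightarrow> ('a \<Rightarrow> int) set \<Rightarrow> ('a \<Rightarrow> int) topology" where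
  "step_topology \<beta> e G =
     (if finite \<beta> then discrete_topology G else Metric_space.mtopology G (step_dist e))"

definition step_borel ::
    "'a set set \<Rightarrow> (nat \<Rightarrow> 'a set) \<Rightarrow> ('a \<Rightarrow> int) set \<Rightarrow> ('a \<Rightarrow> int) measure" where
  "step_borel \<beta> e G = sigma G {U. openin (step_topology \<beta> e G) U}"

definition invertible_transformation :: "'w measure \<Rightarrow> ('w \<Rightarrow> 'w) \<Rightarrow> bool" where
  "invertible_transformation P \<eta> \<longleftrightarrow> bij_betw \<eta> (space P) (space P) \<and> \<eta> \<in> P \<rightarrow>\<^sub>M P \<and>
     the_inv_into (space P) \<eta> \<in> P \<rightarrow>\<^sub>M P"

definition iterate_int :: "'w measure \<Rightarrow> ('w \<Rightarrow> 'w) \<Rightarrow> int \<Rightarrow> 'w \<Rightarrow> 'w" where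
  "iterate_int P \<eta> i =
     (if i \<ge> 0 then \<eta> ^^ nat i else (the_inv_into (space P) \<eta>) ^^ nat (- i))"

definition stationary_environment :: "'w measure \<Rightarrow> ('w \<Rightarrow> 'w) \<Rightarrow> bool" where
  "stationary_environment P \<eta> \<longleftrightarrow> distr P P \<eta> = P"

definition ergodic_environment :: "'w measure \<Rightarrow> ('w \<Rightarrow> 'w) \<Rightarrow> bool" where
  "ergodic_environment P \<eta> \<longleftrightarrow>
     (\<forall>A\<in>sets P. \<eta> -` A \<inter> space P = A \<longrightarrow> measure P A = 0 \<or> measure P A = 1)"

text \<open>
  A function on \<open>X = space M\<close> is represented by a function on the type that is \<open>undefined\<close> outside
  \<open>space M\<close>; otherwise \<open>step_dist\<close> would not separate the points of \<open>G\<close>.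
\<close>
locale dwde = base_map M T \<beta> + P: prob_space P
  for M :: "'a measure" and T :: "'a \<Rightarrow> 'a" and \<beta> :: "'a set set" and e :: "nat \<Rightarrow> 'a set"
    and G :: "('a \<Rightarrow> int) set"
    and P :: "'w measure" and \<eta> :: "'w \<Rightarrow> 'w" and \<phi> :: "'w \<Rightarrow> 'a \<Rightarrow> int" +
  assumes enum: "infinite \<beta> \<Longrightarrow> bij_betw e {1..} \<beta>"
    and G_extensional: "G \<subseteq> extensional (space M)"
    and G_const: "\<And>g a x y. g \<in> G \<Longrightarrow> a \<in> \<beta> \<Longrightarrow> x \<in> a \<Longrightarrow> y \<in> a \<Longrightarrow> g x = g y"
    and invertible: "invertible_transformation P \<eta>"
    and phi_measurable: "\<phi> \<in> P \<rightarrow>\<^sub>M step_borel \<beta> e G"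

lemma (in dwde) Metric_space_step_dist:
  assumes "infinite \<beta>"
  shows "Metric_space G (step_dist e)"
proof -
  define A where "A f g = {n. \<forall>j\<in>{1..n}. \<forall>x\<in>e j. f x = g x}" for f g :: "'a \<Rightarrow> int"
  have fin: "finite (A f g)" if fg: "f \<in> G" "g \<in> G" "f \<noteq> g" for f g
  proof -
    have "\<exists>x\<in>space M. f x \<noteq> g x"
    proof (rule ccontr)
      assume "\<not> ?thesis"
      then have "f = g"
        using fg(1,2) G_extensional by (intro extensionalityI[of f "space M" g]) auto
      with fg(3) show False by contradiction
    qed
    then obtain x where x: "x \<in> space M" "f x \<noteq> g x" by blast
    have "\<Union>\<beta> = space M" using markov by (auto simp: markov_partition_def partition_on_def)
    moreover have "e ` {1..} = \<beta>" using enum[OF assms] by (simp add: bij_betw_def)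
    ultimately obtain j where j: "j \<ge> 1" "x \<in> e j" using x by blast
    have "A f g \<subseteq> {..<j}"
    proof
      fix n assume "n \<in> A f g"
      then have "\<not> j \<le> n" using j x by (auto simp: A_def)
      then show "n \<in> {..<j}" by simp
    qed
    then show ?thesis by (rule finite_subset) simp
  qed
  have sym: "step_dist e f g = step_dist e g f" for f g
  proof -
    have "A f g = A g f" by (auto simp: A_def)
    then show ?thesis by (simp add: step_dist_def agreement_def A_def)
  qed
  have tri: "step_dist e f h \<le> step_dist e f g + step_dist e g h"
    if "f \<in> G" "g \<in> G" "h \<in> G" for f g h
  proof (cases "f = g \<or> g = h \<or> f = h")
    case True
    then show ?thesis by (auto simp: step_dist_def)
  next
    case False
    let ?n = "min (Max (A f g)) (Max (A g h))"
    have "0 \<in> A f g" "0 \<in> A g h" by (auto simp: A_def)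
    then have m: "Max (A f g) \<in> A f g" "Max (A g h) \<in> A g h"
      using Max_in[OF fin[of f g]] Max_in[OF fin[of g h]] False that by blast+
    have "f x = h x" if "j \<in> {1..?n}" "x \<in> e j" for j x
    proof -
      have "j \<in> {1..Max (A f g)}" "j \<in> {1..Max (A g h)}" using that(1) by simp_all
      then have "f x = g x" "g x = h x" using m that(2) unfolding A_def by blast+
      then show ?thesis by (rule trans)
    qed
    then have "?n \<in> A f h" unfolding A_def by blast
    then have "?n \<le> Max (A f h)" using fin[of f h] False that by (intro Max_ge) blast+
    then have "(1/2::real) ^ Max (A f h) \<le> (1/2) ^ ?n" by (intro power_decreasing) auto
    also have "\<dots> \<le> (1/2) ^ Max (A f g) + (1/2) ^ Max (A g h)"
      by (cases "Max (A f g) \<le> Max (A g h)") (auto simp: min_def)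
    finally show ?thesis using False by (simp add: step_dist_def agreement_def A_def)
  qed
  show ?thesis
    by unfold_locales (use sym tri in \<open>auto simp: step_dist_def\<close>)
qed


section \<open>The walk\<close>

definition environment ::
    "'w measure \<Rightarrow> ('w \<Rightarrow> 'w) \<Rightarrow> ('w \<Rightarrow> 'a \<Rightarrow> int) \<Rightarrow> 'w \<Rightarrow> int \<Rightarrow> 'a \<Rightarrow> int" where
  "environment P \<eta> \<phi> \<omega> i = \<phi> (iterate_int P \<eta> i \<omega>)"

definition skew :: "('a \<Rightarrow> 'a) \<Rightarrow> (int \<Rightarrow> 'a \<Rightarrow> int) \<Rightarrow> 'a \<times> int \<Rightarrow> 'a \<times> int" where
  "skew T f = (\<lambda>(x, i). (T x, i + f i x))"

definition walk :: "('a \<Rightarrow> 'a) \<Rightarrow> (int \<Rightarrow> 'a \<Rightarrow> int) \<Rightarrow> int \<Rightarrow> nat \<Rightarrow> 'a \<Rightarrow> int" where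
  "walk T f i n x = snd ((skew T f ^^ n) (x, i))"

definition skew_measure :: "'a measure \<Rightarrow> ('a \<times> int) measure" where
  "skew_measure M = M \<Otimes>\<^sub>M count_space UNIV"

definition skew_partition :: "'a set set \<Rightarrow> ('a \<times> int) set set" where
  "skew_partition \<beta> = {a \<times> {i} | a i. a \<in> \<beta>}"

definition communicates ::
    "'z measure \<Rightarrow> ('z \<Rightarrow> 'z) \<Rightarrow> 'z set \<Rightarrow> 'z set \<Rightarrow> bool" where
  "communicates \<mu> F a b \<longleftrightarrow> emeasure \<mu> {z \<in> a. \<exists>n\<ge>1. (F ^^ n) z \<in> b} > 0"

definition irreducible_partition :: "'z measure \<Rightarrow> ('z \<Rightarrow> 'z) \<Rightarrow> 'z set set \<Rightarrow> bool" where
  "irreducible_partition \<mu> F \<alpha> \<longleftrightarrow> (\<forall>a\<in>\<alpha>. \<forall>b\<in>\<alpha>. communicates \<mu> F a b)"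

definition recurrent_state ::
    "'a measure \<Rightarrow> ('a \<Rightarrow> 'a) \<Rightarrow> (int \<Rightarrow> 'a \<Rightarrow> int) \<Rightarrow> int \<Rightarrow> bool" where
  "recurrent_state M T f i \<longleftrightarrow> measure M {x \<in> space M. \<exists>n\<ge>1. walk T f i n x = i} = 1"

text \<open>
  The cylinder \<open>a \<cdot> c \<cdot> b\<close>, for \<open>c\<close> of rank \<open>n\<close> and \<open>a\<close>, \<open>b\<close> of rank \<open>1\<close>, is
  \<open>a \<inter> F\<^sup>-\<^sup>1 (c \<inter> F\<^sup>-\<^sup>n b)\<close>.
\<close>
definition linked ::
    "'a measure \<Rightarrow> ('a \<Rightarrow> 'a) \<Rightarrow> 'a set set \<Rightarrow> (int \<Rightarrow> 'a \<Rightarrow> int) \<Rightarrow> real \<Rightarrow> bool" where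
  "linked M T \<beta> f r \<longleftrightarrow> (\<forall>a\<in>\<beta>. \<forall>b\<in>\<beta>. \<forall>i j. \<bar>i - j\<bar> = 1 \<longrightarrow>
     b \<times> {j} \<subseteq> skew T f ` (a \<times> {i}) \<or>
     (\<exists>n\<ge>1. \<exists>c\<in>cylinders (skew T f) (skew_partition \<beta>) n.
        emeasure (skew_measure M) c \<ge> ennreal r \<and>
        emeasure (skew_measure M)
          (a \<times> {i} \<inter> skew T f -` (c \<inter> (skew T f ^^ n) -` (b \<times> {j}))) > 0))"

context dwde
begin

abbreviation env :: "'w \<Rightarrow> int \<Rightarrow> 'a \<Rightarrow> int" where
  "env \<equiv> environment P \<eta> \<phi>"

definition U :: "int \<Rightarrow> nat \<Rightarrow> 'a \<Rightarrow> 'w \<Rightarrow> int" where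
  "U i n x \<omega> = walk T (env \<omega>) i n x"

definition irreducible_walk :: bool where
  "irreducible_walk \<longleftrightarrow>
     (AE \<omega> in P. irreducible_partition (skew_measure M) (skew T (env \<omega>)) (skew_partition \<beta>))"

definition linkage_property :: bool where
  "linkage_property \<longleftrightarrow>
     irreducible_walk \<and> (\<exists>r>0. AE \<omega> in P. linked M T \<beta> (env \<omega>) r)"

definition bounded_jumps :: bool where
  "bounded_jumps \<longleftrightarrow> (\<exists>J. finite J \<and> (\<forall>g\<in>G. g ` space M \<subseteq> J))"

definition transient :: bool where
  "transient \<longleftrightarrow> (AE \<omega> in P. \<forall>i. \<not> recurrent_state M T (env \<omega>) i)"

end

end

theory Submission
  imports Defs
begin

text \<open>
  Let \<open>up i\<close> and \<open>down i\<close> be the sets of starting points whose walk from \<open>i\<close> tends to \<open>\<infinity>\<close> and to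
  \<open>-\<infinity>\<close>. Such families, indexed by the state, are invariant under the skew product, and two facts
  hold for every invariant family \<open>E\<close>. First, by distortion and approximation by cylinders, \<open>E i\<close> is
  null if almost every walk in it keeps visiting states \<open>j\<close> for which \<open>E j\<close> misses a fixed amount of
  every image \<open>T a\<close>. Secondly, by linkage, if \<open>E i\<close> nearly fills one image \<open>T a\<close> then \<open>E j\<close> nearly
  fills \<open>X\<close> for all \<open>j\<close> close to \<open>i\<close>, uniformly in the environment.

  Applied to the walks visiting \<open>k\<close> infinitely often, this shows that transient states are left
  for good, so that bounded jumps force almost every walk to tend to \<open>\<infinity>\<close> or \<open>-\<infinity>\<close>. By ergodicity
  \<open>up\<close> is either null for almost every environment or somewhere positive for almost every one. In the
  second case \<open>up\<close> nearly fills \<open>X\<close> throughout some window of states as wide as a jump; by Poincare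
  recurrence such windows occur arbitrarily far to the left, where every walk tending to \<open>-\<infinity>\<close>
  must hit them, and hence \<open>down\<close> is null.
\<close>

section \<open>Cylinders of the base map\<close>

context base_map
begin

section \<open>Measurability of orbits, cells and images of cells\<close>

lemma T_measurable: "T \<in> M \<rightarrow>\<^sub>M M"
  using nonsingular by (simp add: nonsingular_on_def)

lemma T_power_measurable: "(T ^^ n) \<in> M \<rightarrow>\<^sub>M M"
  using T_measurable by (rule measurable_compose_n)

lemma T_power_in_space: "x \<in> space M \<Longrightarrow> (T ^^ n) x \<in> space M"
  using measurable_space[OF T_power_measurable] .

lemma countable_cells: "countable \<beta>"
  using markov by (simp add: markov_partition_def)

lemma cell_sets: "b \<in> \<beta> \<Longrightarrow> b \<in> sets M"
  using markov by (auto simp: markov_partition_def)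

lemma cell_subset: "b \<in> \<beta> \<Longrightarrow> b \<subseteq> space M"
  using cell_sets sets.sets_into_space by blast

lemma Union_cells: "\<Union>\<beta> = space M"
  using markov by (simp add: markov_partition_def partition_on_def)

lemma cell_unique: "a \<in> \<beta> \<Longrightarrow> b \<in> \<beta> \<Longrightarrow> x \<in> a \<Longrightarrow> x \<in> b \<Longrightarrow> a = b"
  using markov unfolding markov_partition_def partition_on_def disjoint_def by blast

lemma cell_of_point: assumes "x \<in> space M" obtains b where "b \<in> \<beta>" "x \<in> b"
  using assms Union_cells by blast

lemma cells_nonempty: "\<beta> \<noteq> {}"
  using Union_cells not_empty by auto

lemma cell_image_sets: assumes "b \<in> \<beta>" shows "T ` b \<in> sets M"
proof -
  obtain S where "S \<subseteq> \<beta>" "T ` b = \<Union>S"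
    using markov assms by (auto simp: markov_partition_def)
  then show ?thesis
    using countable_subset[OF _ countable_cells] cell_sets by (auto intro!: sets.countable_Union)
qed

text \<open>The Markov property in its most used form: the image is a union of cells and distinct
  cells are disjoint, so one common point is enough.\<close>

lemma cell_subset_image:
  assumes "a \<in> \<beta>" "b \<in> \<beta>" "x \<in> b" "x \<in> T ` a" shows "b \<subseteq> T ` a"
proof -
  obtain S where S: "S \<subseteq> \<beta>" "T ` a = \<Union>S"
    using markov assms by (auto simp: markov_partition_def)
  then obtain c where "c \<in> S" "x \<in> c" using assms by auto
  with S show ?thesis using cell_unique[of b c x] assms by blast
qed

lemma image_measure_bound:
  obtains \<delta> where "\<delta> > 0" "\<And>a. a \<in> \<beta> \<Longrightarrow> \<delta> \<le> measure M (T ` a)"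
proof
  show "(INF a\<in>\<beta>. measure M (T ` a)) > 0" using big_image by (simp add: big_image_def)
  show "(INF a\<in>\<beta>. measure M (T ` a)) \<le> measure M (T ` a)" if "a \<in> \<beta>" for a
    using that by (intro cINF_lower) (auto intro!: bdd_belowI[of _ 0])
qed

section \<open>Itineraries and the cylinders through a point\<close>

definition agree :: "nat \<Rightarrow> 'a \<Rightarrow> 'a \<Rightarrow> bool" where
  "agree n x y \<longleftrightarrow> (\<forall>j<n. \<forall>b\<in>\<beta>. (T ^^ j) x \<in> b \<longleftrightarrow> (T ^^ j) y \<in> b)"

text \<open>The rank \<open>n\<close> cylinder named by one of its points instead of a sequence of
  cells. Cylinders of one rank thus become the classes of an equivalence relation, and
  \<open>cyl 0 x\<close> is the whole space.\<close>

definition cyl :: "nat \<Rightarrow> 'a \<Rightarrow> 'a set" where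
  "cyl n x = {y \<in> space M. agree n x y}"

lemma agree_mono: "agree n x y \<Longrightarrow> k \<le> n \<Longrightarrow> agree k x y"
  by (auto simp: agree_def)

lemma agree_sym: "agree n x y \<Longrightarrow> agree n y x"
  by (auto simp: agree_def)

lemma agree_trans: "agree n x y \<Longrightarrow> agree n y z \<Longrightarrow> agree n x z"
  by (auto simp: agree_def)

lemma cyl_self: "x \<in> space M \<Longrightarrow> x \<in> cyl n x"
  by (simp add: cyl_def agree_def)

lemma cyl_subset: "cyl n x \<subseteq> space M"
  by (auto simp: cyl_def)

lemma cyl_eq: "y \<in> cyl n x \<Longrightarrow> cyl n y = cyl n x"
  unfolding cyl_def using agree_sym agree_trans by blast

lemma cyl_Suc:
  assumes "x \<in> space M" "b \<in> \<beta>" "(T ^^ n) x \<in> b"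
  shows "cyl (Suc n) x = cyl n x \<inter> (T ^^ n) -` b"
proof -
  have "agree (Suc n) x y \<longleftrightarrow> agree n x y \<and> (T ^^ n) y \<in> b" if "y \<in> space M" for y
  proof -
    have "(\<forall>c\<in>\<beta>. (T ^^ n) x \<in> c \<longleftrightarrow> (T ^^ n) y \<in> c) \<longleftrightarrow> (T ^^ n) y \<in> b"
      using assms(2,3) cell_unique by blast
    then show ?thesis by (auto simp: agree_def less_Suc_eq)
  qed
  then show ?thesis by (auto simp: cyl_def)
qed

text \<open>Identifies the cylinders of the definition with those named by points. Rank at least 1
  matters because the first cell is what confines a cylinder to \<open>space M\<close>.\<close>

lemma cylinder_eq_cyl:
  assumes "c \<in> cylinders T \<beta> n" "n \<ge> 1" "x \<in> c"
  shows "c = cyl n x" "x \<in> space M"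
proof -
  obtain a where a: "c = (\<Inter>j<n. (T ^^ j) -` a j)" "\<forall>j<n. a j \<in> \<beta>"
    using assms(1) by (auto simp: cylinders_def)
  have sub: "c \<subseteq> space M"
  proof
    fix y assume "y \<in> c"
    then have "y \<in> a 0" using a(1) assms(2) by force
    then show "y \<in> space M" using a(2) assms(2) cell_subset by force
  qed
  then show "x \<in> space M" using assms by blast
  show "c = cyl n x"
  proof
    show "c \<subseteq> cyl n x"
    proof
      fix y assume y: "y \<in> c"
      have "(T ^^ j) x \<in> b \<longleftrightarrow> (T ^^ j) y \<in> b" if "j < n" "b \<in> \<beta>" for j b
      proof -
        have "(T ^^ j) x \<in> a j" "(T ^^ j) y \<in> a j" using y assms(3) a(1) that by auto
        then show ?thesis using cell_unique a(2) that by metis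
      qed
      then show "y \<in> cyl n x" using y sub by (auto simp: cyl_def agree_def)
    qed
    show "cyl n x \<subseteq> c"
    proof
      fix y assume y: "y \<in> cyl n x"
      have "(T ^^ j) y \<in> a j" if "j < n" for j
        using y assms(3) a that by (auto simp: cyl_def agree_def)
      then show "y \<in> c" using a(1) by auto
    qed
  qed
qed

lemma cyl_in_cylinders:
  assumes x: "x \<in> space M" and n: "n \<ge> 1"
  shows "cyl n x \<in> cylinders T \<beta> n"
proof -
  have "\<exists>b. b \<in> \<beta> \<and> (T ^^ j) x \<in> b" for j
    using T_power_in_space[OF x] cell_of_point by metis
  then obtain a where a: "\<And>j. a j \<in> \<beta>" "\<And>j. (T ^^ j) x \<in> a j" by metis
  have c: "(\<Inter>j<n. (T ^^ j) -` a j) \<in> cylinders T \<beta> n" using a by (auto simp: cylinders_def)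
  moreover have "x \<in> (\<Inter>j<n. (T ^^ j) -` a j)" using a by auto
  ultimately show ?thesis using cylinder_eq_cyl(1)[OF c n] by simp
qed

lemma cyl_sets: assumes "x \<in> space M" shows "cyl n x \<in> sets M"
proof (induction n)
  case 0
  have "cyl 0 x = space M" by (auto simp: cyl_def agree_def)
  then show ?case by simp
next
  case (Suc n)
  obtain b where b: "b \<in> \<beta>" "(T ^^ n) x \<in> b"
    using T_power_in_space[OF assms] cell_of_point by metis
  have "cyl (Suc n) x = cyl n x \<inter> ((T ^^ n) -` b \<inter> space M)"
    using cyl_Suc[OF assms b] cyl_subset by blast
  then show ?case using Suc measurable_sets[OF T_power_measurable cell_sets[OF b(1)]] by simp
qed

lemma countable_cyls: "countable (cyl n ` space M)"
proof (induction n)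
  case 0
  have "cyl 0 ` space M \<subseteq> {space M}" by (auto simp: cyl_def agree_def)
  then show ?case by (rule countable_subset) simp
next
  case (Suc n)
  have "cyl (Suc n) ` space M \<subseteq> (\<lambda>(c, b). c \<inter> (T ^^ n) -` b) ` (cyl n ` space M \<times> \<beta>)"
  proof
    fix c assume "c \<in> cyl (Suc n) ` space M"
    then obtain x where x: "x \<in> space M" "c = cyl (Suc n) x" by blast
    obtain b where "b \<in> \<beta>" "(T ^^ n) x \<in> b"
      using T_power_in_space[OF x(1)] cell_of_point by metis
    then show "c \<in> (\<lambda>(c, b). c \<inter> (T ^^ n) -` b) ` (cyl n ` space M \<times> \<beta>)"
      using x cyl_Suc by force
  qed
  then show ?case by (rule countable_subset) (use Suc countable_cells in simp)
qed

text \<open>Induction on \<open>n\<close>: if T^n carries the cylinder onto the cell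
  \<open>a\<close>, then T^(n+1) carries it onto T(a), which contains the next cell \<open>b\<close>
  by the Markov property; passing to the cylinder of the next rank cuts this image down to exactly
  \<open>b\<close>.\<close>

lemma cyl_image:
  assumes x: "x \<in> space M" and b: "b \<in> \<beta>" "(T ^^ n) x \<in> b"
  shows "(T ^^ n) ` cyl (Suc n) x = b"
  using b
proof (induction n arbitrary: b)
  case 0
  then show ?case using cyl_Suc[OF x, of b 0] cell_subset[of b] by (auto simp: cyl_def agree_def)
next
  case (Suc n)
  obtain a where a: "a \<in> \<beta>" "(T ^^ n) x \<in> a"
    using T_power_in_space[OF x] cell_of_point by metis
  have "(T ^^ Suc n) ` cyl (Suc n) x = T ` a"
    unfolding funpow.simps(2) image_comp[symmetric] Suc.IH[OF a] ..
  moreover have "b \<subseteq> T ` a"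
    by (rule cell_subset_image[of a b "(T ^^ Suc n) x"]) (use a Suc.prems in auto)
  moreover have "f ` (A \<inter> f -` b) = f ` A \<inter> b" for f :: "'a \<Rightarrow> 'a" and A by auto
  ultimately show ?case
    unfolding cyl_Suc[OF x Suc.prems] by (simp only: Int_absorb1)
qed

lemma cyl_image_Suc:
  assumes "x \<in> space M" "b \<in> \<beta>" "(T ^^ n) x \<in> b"
  shows "(T ^^ Suc n) ` cyl (Suc n) x = T ` b"
  unfolding funpow.simps(2) image_comp[symmetric] cyl_image[OF assms] ..

text \<open>Strong distortion integrated over \<open>B\<close>, as a lower bound for the part of a
  cylinder that lands in \<open>B\<close>. Here \<open>b\<close> is the last cell of the cylinder
  through \<open>x\<close>, so T(b) is the full image of the cylinder by
  \<open>cyl_image_Suc\<close>.\<close>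

definition distortion_bound :: "real \<Rightarrow> bool" where
  "distortion_bound D \<longleftrightarrow> D \<ge> 1 \<and> (\<forall>n. \<forall>x\<in>space M. \<forall>b\<in>\<beta>. \<forall>B\<in>sets M. (T ^^ n) x \<in> b \<longrightarrow>
     measure M (cyl (Suc n) x) * measure M (B \<inter> T ` b)
       \<le> D * measure M (cyl (Suc n) x \<inter> (T ^^ Suc n) -` B))"

lemma distortion_boundD:
  assumes "distortion_bound D"
  shows "D \<ge> 1"
    and "x \<in> space M \<Longrightarrow> b \<in> \<beta> \<Longrightarrow> (T ^^ n) x \<in> b \<Longrightarrow> B \<in> sets M \<Longrightarrow>
      measure M (cyl (Suc n) x) * measure M (B \<inter> T ` b)
        \<le> D * measure M (cyl (Suc n) x \<inter> (T ^^ Suc n) -` B)"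
  using assms unfolding distortion_bound_def by blast+

text \<open>The pointwise bound on the derivative \<open>v\<close> is integrated twice: in the
  second variable over the part of T(b) in \<open>B\<close>, then in the first over T(b). The
  integral of \<open>v\<close> over T(b) is the measure of the cylinder; the factor left on the
  right, the measure of T(b), is at most 1.\<close>

lemma distortion: obtains D where "distortion_bound D"
proof -
  obtain D where D: "D \<ge> 1" and dist: "\<And>n c. n \<ge> 1 \<Longrightarrow> c \<in> cylinders T \<beta> n \<Longrightarrow>
      AE x in M. AE y in M. x \<in> (T ^^ n) ` c \<longrightarrow> y \<in> (T ^^ n) ` c \<longrightarrow>
        cyl_deriv M T n c x \<le> ennreal D * cyl_deriv M T n c y"
    using strong_distortion unfolding strong_distortion_def by blast
  show thesis
  proof (rule that, unfold distortion_bound_def, intro conjI allI ballI impI)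
    show "D \<ge> 1" by fact
    fix n x b B assume x: "x \<in> space M" and b1: "b \<in> \<beta>" and B: "B \<in> sets M" and b2: "(T ^^ n) x \<in> b"
    note b = b1 b2
    define c where "c = cyl (Suc n) x"
    define v where "v = cyl_deriv M T (Suc n) c"
    have v: "v \<in> borel_measurable M" by (simp add: v_def cyl_deriv_def)
    have im: "(T ^^ Suc n) ` c = T ` b" unfolding c_def by (rule cyl_image_Suc[OF x b])
    have I: "T ` b \<in> sets M" by (rule cell_image_sets[OF b(1)])
    have c: "c \<in> sets M" using x by (simp add: c_def cyl_sets)
    have int: "(\<integral>\<^sup>+y\<in>T ` b \<inter> C. v y \<partial>M) = emeasure M (c \<inter> (T ^^ Suc n) -` C)" if "C \<in> sets M" for C
      using set_nn_integral_cyl_deriv[of c "Suc n" C] im I c that by (simp add: v_def)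
    have "AE z in M. AE y in M. z \<in> T ` b \<longrightarrow> y \<in> T ` b \<longrightarrow> v z \<le> ennreal D * v y"
      using dist[of "Suc n" c] cyl_in_cylinders[OF x, of "Suc n"] im unfolding v_def c_def by simp
    then have "AE z in M. z \<in> T ` b \<longrightarrow> v z * emeasure M (T ` b \<inter> B) \<le> ennreal D * emeasure M (c \<inter> (T ^^ Suc n) -` B)"
    proof eventually_elim
      case (elim z)
      show ?case
      proof
        assume z: "z \<in> T ` b"
        have "v z * emeasure M (T ` b \<inter> B) = (\<integral>\<^sup>+y. v z * indicator (T ` b \<inter> B) y \<partial>M)"
          using I B by (simp add: nn_integral_cmult)
        also have "\<dots> \<le> (\<integral>\<^sup>+y. ennreal D * (v y * indicator (T ` b \<inter> B) y) \<partial>M)"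
          using elim z by (intro nn_integral_mono_AE) (auto elim!: eventually_mono simp: indicator_def)
        also have "\<dots> = ennreal D * (\<integral>\<^sup>+y. v y * indicator (T ` b \<inter> B) y \<partial>M)"
          using v I B by (intro nn_integral_cmult) auto
        finally show "v z * emeasure M (T ` b \<inter> B) \<le> ennreal D * emeasure M (c \<inter> (T ^^ Suc n) -` B)"
          using int[OF B] by simp
      qed
    qed
    then have "(\<integral>\<^sup>+z. v z * emeasure M (T ` b \<inter> B) * indicator (T ` b) z \<partial>M)
        \<le> (\<integral>\<^sup>+z. ennreal D * emeasure M (c \<inter> (T ^^ Suc n) -` B) * indicator (T ` b) z \<partial>M)"
      by (intro nn_integral_mono_AE) (auto elim!: eventually_mono simp: indicator_def)
    also have "\<dots> = ennreal D * emeasure M (c \<inter> (T ^^ Suc n) -` B) * emeasure M (T ` b)"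
      using I by (simp add: nn_integral_cmult)
    also have "\<dots> \<le> ennreal D * emeasure M (c \<inter> (T ^^ Suc n) -` B) * 1"
      by (intro mult_left_mono emeasure_le_1) auto
    also have "(\<integral>\<^sup>+z. v z * emeasure M (T ` b \<inter> B) * indicator (T ` b) z \<partial>M)
        = (\<integral>\<^sup>+z. v z * indicator (T ` b) z * emeasure M (T ` b \<inter> B) \<partial>M)"
      by (simp add: ac_simps)
    also have "\<dots> = (\<integral>\<^sup>+z. v z * indicator (T ` b) z \<partial>M) * emeasure M (T ` b \<inter> B)"
      using v I by (intro nn_integral_multc) auto
    also have "(\<integral>\<^sup>+z. v z * indicator (T ` b) z \<partial>M) = emeasure M c"
    proof -
      have "c \<inter> (T ^^ Suc n) -` space M = c"
        using T_power_in_space[of _ "Suc n"] cyl_subset unfolding c_def by blast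
      moreover have "T ` b \<inter> space M = T ` b" using I sets.sets_into_space by blast
      ultimately show ?thesis using int[of "space M"] by simp
    qed
    finally show "measure M (cyl (Suc n) x) * measure M (B \<inter> T ` b)
         \<le> D * measure M (cyl (Suc n) x \<inter> (T ^^ Suc n) -` B)"
      using D unfolding c_def[symmetric] emeasure_eq_measure
      by (simp add: ennreal_mult'[symmetric] Int_commute)
  qed
qed

end

section \<open>Invariant families of the skew product\<close>

text \<open>Induction over the generated sigma-algebra. Only countable unions take work: the union
  is cut off after finitely many sets at a cost of \<epsilon> / 2, and these are approximated one by
  one within a total of \<epsilon> / 2.\<close>

lemma (in finite_measure) approximate_by_algebra:
  assumes alg: "algebra (space M) \<A>" and sub: "\<A> \<subseteq> sets M"
    and "A \<in> sigma_sets (space M) \<A>" and "0 < (\<epsilon>::real)"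
  shows "\<exists>B\<in>\<A>. measure M ((A - B) \<union> (B - A)) < \<epsilon>"
  using assms(3,4)
proof (induction arbitrary: \<epsilon>)
  case (Basic A)
  then show ?case by (intro bexI[of _ A]) auto
next
  case Empty
  interpret algebra "space M" \<A> by (rule alg)
  show ?case using Empty by (intro bexI[of _ "{}"]) auto
next
  case (Compl A)
  interpret A: algebra "space M" \<A> by (rule alg)
  obtain B where B: "B \<in> \<A>" "measure M ((A - B) \<union> (B - A)) < \<epsilon>"
    using Compl.IH[OF Compl.prems] by blast
  have "A \<subseteq> space M" "B \<subseteq> space M"
    using sigma_sets_into_sp[OF A.space_closed Compl.hyps] B(1) A.space_closed by auto
  then have "(space M - A - (space M - B)) \<union> (space M - B - (space M - A)) = (A - B) \<union> (B - A)"
    by blast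
  then show ?case using B by (intro bexI[of _ "space M - B"]) auto
next
  case (Union a)
  interpret A: algebra "space M" \<A> by (rule alg)
  have a: "a i \<in> sets M" for i
    using Union.hyps[of i] sub sets.sigma_sets_subset by blast
  define u where "u n = (\<Union>i<n. a i)" for n :: nat
  have u: "range u \<subseteq> sets M" "incseq u"
    using a by (force simp: u_def incseq_def)+
  have uU: "(\<Union>n. u n) = (\<Union>i. a i)" by (auto simp: u_def)
  have "(\<lambda>n. measure M (u n)) \<longlonglongrightarrow> measure M (\<Union>i. a i)"
    using finite_Lim_measure_incseq[OF u] uU by simp
  then have "\<forall>\<^sub>F n in sequentially. measure M (\<Union>i. a i) - \<epsilon> / 2 < measure M (u n)"
    using Union.prems by (intro order_tendstoD) auto
  then obtain n where n: "measure M (\<Union>i. a i) - \<epsilon> / 2 < measure M (u n)"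
    by (auto simp: eventually_sequentially)
  \<comment> \<open>\<open>Suc n\<close> rather than \<open>n\<close> in the share of each set keeps
    the denominator positive when \<open>n\<close> is 0.\<close>
  have "\<exists>B\<in>\<A>. measure M ((a i - B) \<union> (B - a i)) < \<epsilon> / (2 * Suc n)" for i
    using Union.IH[of "\<epsilon> / (2 * Suc n)" i] Union.prems by simp
  then obtain b where b: "\<And>i. b i \<in> \<A>"
    "\<And>i. measure M ((a i - b i) \<union> (b i - a i)) < \<epsilon> / (2 * Suc n)" by metis
  have bM: "b i \<in> sets M" for i using b sub by blast
  define B where "B = (\<Union>i<n. b i)"
  have BA: "B \<in> \<A>" unfolding B_def using b by (intro A.finite_UN) auto
  have "(\<Union>i. a i) - B \<union> (B - (\<Union>i. a i))
      \<subseteq> ((\<Union>i. a i) - u n) \<union> (\<Union>i<n. (a i - b i) \<union> (b i - a i))"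
    unfolding B_def u_def by blast
  then have "measure M ((\<Union>i. a i) - B \<union> (B - (\<Union>i. a i)))
      \<le> measure M (((\<Union>i. a i) - u n) \<union> (\<Union>i<n. (a i - b i) \<union> (b i - a i)))"
    using a bM u by (intro finite_measure_mono) auto
  also have "\<dots> \<le> measure M ((\<Union>i. a i) - u n) + measure M (\<Union>i<n. (a i - b i) \<union> (b i - a i))"
    using a bM u by (intro measure_Un_le) auto
  also have "measure M ((\<Union>i. a i) - u n) = measure M (\<Union>i. a i) - measure M (u n)"
    using a u by (intro finite_measure_Diff) (auto simp: u_def)
  also have "measure M (\<Union>i<n. (a i - b i) \<union> (b i - a i)) \<le> (\<Sum>i<n. measure M ((a i - b i) \<union> (b i - a i)))"
    using a bM by (intro measure_UNION_le) auto
  also have "\<dots> \<le> (\<Sum>i<n. \<epsilon> / (2 * Suc n))" using b(2) by (intro sum_mono less_imp_le)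
  also have "\<dots> \<le> \<epsilon> / 2" using Union.prems by (simp add: field_simps)
  finally show ?case using n BA by (intro bexI[of _ B]) auto
qed

text \<open>The bound is summed over the disjoint sets of \<C>, as an integral over a counting
  measure in \<open>ennreal\<close>, where convergence is no issue.\<close>

lemma (in finite_measure) measure_Int_Union_le:
  assumes C: "countable \<C>" "\<C> \<subseteq> sets M" "disjoint \<C>" and A: "A \<in> sets M" and q: "0 \<le> q"
    and le: "\<And>c. c \<in> \<C> \<Longrightarrow> measure M (A \<inter> c) \<le> q * measure M c"
  shows "measure M (A \<inter> \<Union>\<C>) \<le> q * measure M (\<Union>\<C>)"
proof -
  have UC: "\<Union>\<C> \<in> sets M" using C by (intro sets.countable_Union)
  have dis: "disjoint_family_on (\<lambda>c. c) \<C>" "disjoint_family_on (\<lambda>c. A \<inter> c) \<C>"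
    using C(3) by (auto simp: disjoint_family_on_def disjoint_def)
  have "A \<inter> \<Union>\<C> = (\<Union>c\<in>\<C>. A \<inter> c)" by auto
  moreover have "emeasure M (\<Union>c\<in>\<C>. A \<inter> c) = (\<integral>\<^sup>+c. emeasure M (A \<inter> c) \<partial>count_space \<C>)"
    by (rule emeasure_UN_countable) (use C A dis in auto)
  ultimately have "emeasure M (A \<inter> \<Union>\<C>) = (\<integral>\<^sup>+c. emeasure M (A \<inter> c) \<partial>count_space \<C>)" by simp
  also have "\<dots> \<le> (\<integral>\<^sup>+c. ennreal q * emeasure M c \<partial>count_space \<C>)"
    using le q by (intro nn_integral_mono) (simp add: emeasure_eq_measure ennreal_mult'[symmetric])
  also have "\<dots> = ennreal q * (\<integral>\<^sup>+c. emeasure M c \<partial>count_space \<C>)"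
    by (rule nn_integral_cmult) simp
  also have "(\<integral>\<^sup>+c. emeasure M c \<partial>count_space \<C>) = emeasure M (\<Union>\<C>)"
    using emeasure_UN_countable[of \<C> "\<lambda>c. c" M] C dis by (simp add: subset_eq)
  finally show ?thesis using q
    by (simp add: emeasure_eq_measure ennreal_mult'[symmetric])
qed

section \<open>Iterates of the skew product\<close>

lemma skew_power: "(skew T f ^^ n) (x, i) = ((T ^^ n) x, walk T f i n x)"
proof -
  have "fst ((skew T f ^^ n) (x, i)) = (T ^^ n) x"
    by (induction n) (auto simp: skew_def case_prod_beta)
  then show ?thesis by (simp add: walk_def prod_eq_iff)
qed

lemma walk_0 [simp]: "walk T f i 0 x = i"
  by (simp add: walk_def)

lemma walk_Suc: "walk T f i (Suc n) x = walk T f i n x + f (walk T f i n x) ((T ^^ n) x)"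
proof -
  have "walk T f i (Suc n) x = snd (skew T f ((skew T f ^^ n) (x, i)))" by (simp add: walk_def)
  then show ?thesis by (simp only: skew_power) (simp add: skew_def)
qed

text \<open>First-step decomposition, the counterpart of the last-step recursion
  \<open>walk_Suc\<close>; it makes tail events of the walk invariant under the skew
  product.\<close>

lemma walk_Suc_shift: "walk T f i (Suc n) x = walk T f (i + f i x) n (T x)"
proof -
  have "walk T f i (Suc n) x = snd ((skew T f ^^ n) (skew T f (x, i)))"
    unfolding walk_def by (simp only: funpow_Suc_right o_apply)
  then show ?thesis by (simp add: walk_def skew_def)
qed

context base_map
begin

definition cell_const :: "(int \<Rightarrow> 'a \<Rightarrow> int) \<Rightarrow> bool" where
  "cell_const f \<longleftrightarrow> (\<forall>i. \<forall>b\<in>\<beta>. \<forall>x\<in>b. \<forall>y\<in>b. f i x = f i y)"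

text \<open>Each jump depends only on the current state and the cell of the current point, so the
  itinerary of length \<open>n\<close> determines the position at time \<open>n\<close>.\<close>

lemma walk_agree:
  assumes f: "cell_const f" and x: "x \<in> space M" and "agree n x y"
  shows "walk T f i n x = walk T f i n y"
  using assms(3)
proof (induction n)
  case (Suc n)
  have IH: "walk T f i n x = walk T f i n y" using Suc agree_mono by simp
  obtain b where b: "b \<in> \<beta>" "(T ^^ n) x \<in> b" using T_power_in_space[OF x] cell_of_point by metis
  then have "(T ^^ n) y \<in> b" using Suc.prems by (auto simp: agree_def)
  then have "f j ((T ^^ n) x) = f j ((T ^^ n) y)" for j using f b unfolding cell_const_def by blast
  then show ?case using IH by (simp add: walk_Suc)
qed simp

definition cyl_algebra :: "'a set set" where
  "cyl_algebra = {B. B \<subseteq> space M \<and> (\<exists>n. \<forall>x\<in>B. cyl n x \<subseteq> B)}"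

text \<open>Only the space and the sigma-algebra of this measure matter. The sigma-algebra may be
  smaller than \<open>sets M\<close>, but its members can be approximated by unions of cylinders of
  one rank.\<close>

definition cyl_measure :: "'a measure" where
  "cyl_measure = sigma (space M) cyl_algebra"

lemma cyl_antimono: "m \<le> n \<Longrightarrow> cyl n x \<subseteq> cyl m x"
  using agree_mono by (auto simp: cyl_def)

lemma algebra_cyl_algebra: "algebra (space M) cyl_algebra"
proof (rule algebra_iff_Un[THEN iffD2], intro conjI ballI)
  show "cyl_algebra \<subseteq> Pow (space M)" "{} \<in> cyl_algebra" by (auto simp: cyl_algebra_def)
next
  fix A assume A: "A \<in> cyl_algebra"
  then obtain n where n: "\<And>x. x \<in> A \<Longrightarrow> cyl n x \<subseteq> A" "A \<subseteq> space M" by (auto simp: cyl_algebra_def)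
  have "cyl n x \<subseteq> space M - A" if x: "x \<in> space M - A" for x
  proof
    fix y assume y: "y \<in> cyl n x"
    have "x \<in> cyl n y" using cyl_eq[OF y] cyl_self x by blast
    then show "y \<in> space M - A" using y n x cyl_subset by blast
  qed
  then show "space M - A \<in> cyl_algebra" by (auto simp: cyl_algebra_def)
next
  fix A B assume "A \<in> cyl_algebra" "B \<in> cyl_algebra"
  then obtain n m where n: "\<And>x. x \<in> A \<Longrightarrow> cyl n x \<subseteq> A" "\<And>x. x \<in> B \<Longrightarrow> cyl m x \<subseteq> B"
      "A \<subseteq> space M" "B \<subseteq> space M"
    unfolding cyl_algebra_def by blast
  have "cyl (max m n) x \<subseteq> A \<union> B" if "x \<in> A \<union> B" for x
    using that n(1,2)[of x] cyl_antimono[of n "max m n" x] cyl_antimono[of m "max m n" x] by auto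
  then show "A \<union> B \<in> cyl_algebra" unfolding cyl_algebra_def using n(3,4) by blast
qed

lemma cyl_algebra_sets: "cyl_algebra \<subseteq> sets M"
proof
  fix B assume "B \<in> cyl_algebra"
  then obtain n where n: "\<And>x. x \<in> B \<Longrightarrow> cyl n x \<subseteq> B" "B \<subseteq> space M" by (auto simp: cyl_algebra_def)
  have eq: "B = \<Union>(cyl n ` B)" using n cyl_self by blast
  have "countable (cyl n ` B)"
    by (rule countable_subset[OF image_mono countable_cyls]) (rule n(2))
  moreover have "cyl n ` B \<subseteq> sets M" using n(2) cyl_sets by auto
  ultimately show "B \<in> sets M" by (subst eq) (rule sets.countable_Union)
qed

lemma space_cyl_measure [simp]: "space cyl_measure = space M"
  by (simp add: cyl_measure_def space_measure_of_conv)

lemma sets_cyl_measure: "sets cyl_measure = sigma_sets (space M) cyl_algebra"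
  unfolding cyl_measure_def by (rule sets_measure_of) (auto simp: cyl_algebra_def)

lemma cyl_measure_sets: "A \<in> sets cyl_measure \<Longrightarrow> A \<in> sets M"
  using sets.sigma_sets_subset[OF cyl_algebra_sets] by (auto simp: sets_cyl_measure)

lemma walk_cyl_measurable:
  assumes f: "cell_const f"
  shows "walk T f i n \<in> cyl_measure \<rightarrow>\<^sub>M count_space UNIV"
proof (rule measurableI)
  fix A :: "int set"
  have "walk T f i n -` A \<inter> space M \<in> cyl_algebra"
    unfolding cyl_algebra_def
    using walk_agree[OF f] by (auto simp: cyl_def intro!: exI[of _ n])
  then show "walk T f i n -` A \<inter> space cyl_measure \<in> sets cyl_measure"
    by (simp add: sets_cyl_measure sigma_sets.Basic)
qed simp

text \<open>\<open>E\<close> codes the subset {(x, i). x \<in> E i} of X \<times> Z, and the second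
  condition says that this subset is its own preimage under \<open>skew T f\<close>. Measurability
  with respect to cylinders is what permits approximation by them.\<close>

definition skew_invariant :: "(int \<Rightarrow> 'a \<Rightarrow> int) \<Rightarrow> (int \<Rightarrow> 'a set) \<Rightarrow> bool" where
  "skew_invariant f E \<longleftrightarrow> (\<forall>i. E i \<in> sets cyl_measure) \<and>
     (\<forall>i. \<forall>x\<in>space M. x \<in> E i \<longleftrightarrow> T x \<in> E (i + f i x))"

lemma skew_invariant_sets: "skew_invariant f E \<Longrightarrow> E i \<in> sets M"
  using cyl_measure_sets by (auto simp: skew_invariant_def)

lemma skew_invariant_walk:
  assumes "skew_invariant f E" "x \<in> space M"
  shows "x \<in> E i \<longleftrightarrow> (T ^^ n) x \<in> E (walk T f i n x)"
proof (induction n)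
  case (Suc n)
  then show ?case using assms T_power_in_space[of x n] by (simp add: skew_invariant_def walk_Suc)
qed simp

text \<open>All points of the cylinder share the same walk up to time \<open>Suc n\<close>, so by
  invariance a point sent by T^(Suc n) outside the member of \<open>E\<close> at the common endpoint
  was itself outside \<open>E i\<close>. The distortion bound is applied to the complement of that
  member.\<close>

lemma skew_invariant_escape:
  assumes f: "cell_const f" and E: "skew_invariant f E"
    and dist: "distortion_bound D"
    and x: "x \<in> space M" and a: "a \<in> \<beta>" "(T ^^ n) x \<in> a"
  shows "measure M (cyl (Suc n) x) * measure M (T ` a - E (walk T f i (Suc n) x))
      \<le> D * measure M (cyl (Suc n) x - E i)"
proof -
  note D = distortion_boundD[OF dist]
  define B where "B = space M - E (walk T f i (Suc n) x)"
  have B: "B \<in> sets M" using skew_invariant_sets[OF E] by (simp add: B_def)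
  have Ta: "B \<inter> T ` a = T ` a - E (walk T f i (Suc n) x)"
    using cell_image_sets[OF a(1)] sets.sets_into_space by (auto simp: B_def)
  have "cyl (Suc n) x \<inter> (T ^^ Suc n) -` B \<subseteq> cyl (Suc n) x - E i"
  proof
    fix y assume y: "y \<in> cyl (Suc n) x \<inter> (T ^^ Suc n) -` B"
    then have "y \<in> space M" "agree (Suc n) x y" by (auto simp: cyl_def)
    then have "walk T f i (Suc n) x = walk T f i (Suc n) y" using walk_agree[OF f x] by blast
    then have "y \<notin> E i" using y skew_invariant_walk[OF E \<open>y \<in> space M\<close>, of i "Suc n"] by (auto simp: B_def)
    then show "y \<in> cyl (Suc n) x - E i" using y by blast
  qed
  then have "measure M (cyl (Suc n) x \<inter> (T ^^ Suc n) -` B) \<le> measure M (cyl (Suc n) x - E i)"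
    using cyl_sets[OF x] skew_invariant_sets[OF E] by (intro finite_measure_mono) auto
  then have "D * measure M (cyl (Suc n) x \<inter> (T ^^ Suc n) -` B) \<le> D * measure M (cyl (Suc n) x - E i)"
    using D(1) by simp
  then show ?thesis using D(2)[OF x a B] unfolding Ta by (rule order_trans[rotated])
qed

text \<open>The walk is stopped at its first visit to \<open>S\<close> after time \<open>N\<close>; on each of the resulting
  cylinders the distortion bound takes away a fixed proportion of \<open>E i\<close>, which is impossible
  for a set that is well approximated by unions of cylinders of rank \<open>N\<close>.\<close>
lemma skew_invariant_null:
  assumes f: "cell_const f" and E: "skew_invariant f E" and \<kappa>: "\<kappa> > 0"
    and S: "\<And>j a. j \<in> S \<Longrightarrow> a \<in> \<beta> \<Longrightarrow> \<kappa> \<le> measure M (T ` a - E j)"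
    and vis: "AE x in M. x \<in> E i \<longrightarrow> (\<forall>N. \<exists>n\<ge>N. walk T f i n x \<in> S)"
  shows "measure M (E i) = 0"
proof -
  obtain D where dist: "distortion_bound D" using distortion by blast
  then have D: "D \<ge> 1" by (rule distortion_boundD)
  \<comment> \<open>Each stopped cylinder loses at least the proportion \<kappa> / D of its mass to
    the complement of \<open>E i\<close>. The maximum with 0 keeps \<open>q\<close> nonnegative also
    when \<open>S\<close> is empty and \<kappa> is large.\<close>
  define q where "q = max 0 (1 - \<kappa> / D)"
  have q: "0 \<le> q" "q < 1" using \<kappa> D by (auto simp: q_def)
  have EM: "E i \<in> sets M" using skew_invariant_sets[OF E] .
  have cyl_le: "measure M (E i \<inter> cyl n x) \<le> q * measure M (cyl n x)"
    if x: "x \<in> space M" and n: "n \<ge> 1" and wS: "walk T f i n x \<in> S" for x n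
  proof -
    obtain k where k: "n = Suc k" using n by (cases n) auto
    obtain a where a: "a \<in> \<beta>" "(T ^^ k) x \<in> a" using T_power_in_space[OF x] cell_of_point by metis
    have "measure M (cyl n x) * \<kappa> \<le> measure M (cyl n x) * measure M (T ` a - E (walk T f i n x))"
      using S[OF wS a(1)] by (intro mult_left_mono) auto
    also have "\<dots> \<le> D * measure M (cyl n x - E i)"
      unfolding k by (rule skew_invariant_escape[OF f E dist x a])
    also have "measure M (cyl n x - E i) = measure M (cyl n x) - measure M (E i \<inter> cyl n x)"
      using finite_measure_Diff'[OF cyl_sets[OF x] EM] by (simp add: Int_commute)
    finally have "measure M (E i \<inter> cyl n x) \<le> (1 - \<kappa> / D) * measure M (cyl n x)"
      using D by (simp add: field_simps)
    also have "\<dots> \<le> q * measure M (cyl n x)" by (intro mult_right_mono) (auto simp: q_def)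
    finally show ?thesis .
  qed
  have alg_le: "measure M (E i \<inter> B) \<le> q * measure M B" if "B \<in> cyl_algebra" for B
  proof -
    have BM: "B \<in> sets M" using that cyl_algebra_sets by blast
    obtain N0 where N0: "\<And>x. x \<in> B \<Longrightarrow> cyl N0 x \<subseteq> B" "B \<subseteq> space M"
      using \<open>B \<in> cyl_algebra\<close> by (auto simp: cyl_algebra_def)
    \<comment> \<open>\<open>N \<ge> N0\<close> keeps the stopped cylinders inside \<open>B\<close>,
      and \<open>N \<ge> 1\<close> is what \<open>cyl_le\<close> requires of the stopping
      time.\<close>
    define N where "N = max 1 N0"
    define hit where "hit n x \<longleftrightarrow> n \<ge> N \<and> walk T f i n x \<in> S \<and> (\<forall>m. N \<le> m \<and> m < n \<longrightarrow> walk T f i m x \<notin> S)"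
      for n x
    define \<C> where "\<C> = {cyl n x | n x. x \<in> B \<and> hit n x}"
    \<comment> \<open>The stopping rule looks only at the walk up to time \<open>n\<close>, hence is
      constant on a cylinder of rank \<open>n\<close>; as the stopping time is unique, two stopped
      cylinders that meet coincide.\<close>
    have hit_agree: "hit n y" if "hit n x" "x \<in> space M" "agree n x y" for n x y
      using that walk_agree[OF f, of x _ y i] agree_mono[of n x y] unfolding hit_def
      by (metis less_imp_le order_refl)
    have hit_unique: "m = n" if "hit m x" "hit n x" for m n x
      using that unfolding hit_def by (meson linorder_less_linear)
    have "\<C> \<subseteq> (\<Union>n. cyl n ` space M)" using N0(2) by (auto simp: \<C>_def)
    then have cC: "countable \<C>" by (rule countable_subset) (simp add: countable_cyls)
    have CM: "\<C> \<subseteq> sets M" using N0(2) cyl_sets by (auto simp: \<C>_def)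
    have dC: "disjoint \<C>"
    proof (rule disjointI, rule ccontr)
      fix c d assume cd: "c \<in> \<C>" "d \<in> \<C>" "c \<noteq> d" "c \<inter> d \<noteq> {}"
      then obtain m x n y z where *: "c = cyl m x" "d = cyl n y" "x \<in> B" "y \<in> B" "hit m x" "hit n y"
        "z \<in> cyl m x" "z \<in> cyl n y" unfolding \<C>_def by blast
      then have "hit m z" "hit n z" using hit_agree[of m x z] hit_agree[of n y z] N0(2)
        by (auto simp: cyl_def)
      then have "m = n" by (rule hit_unique)
      then show False using * cyl_eq[of z n x] cyl_eq[of z n y] cd(3) by metis
    qed
    have UC: "\<Union>\<C> \<in> sets M" using cC CM by (intro sets.countable_Union)
    have UCB: "\<Union>\<C> \<subseteq> B"
    proof -
      have "cyl n x \<subseteq> B" if "x \<in> B" "hit n x" for n x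
        using that N0(1)[of x] cyl_antimono[of N0 n x] by (auto simp: hit_def N_def)
      then show ?thesis by (auto simp: \<C>_def)
    qed
    have "AE x in M. x \<in> E i \<inter> B \<longrightarrow> x \<in> E i \<inter> \<Union>\<C>"
      using vis
    proof eventually_elim
      case (elim x)
      show ?case
      proof
        assume x: "x \<in> E i \<inter> B"
        define n where "n = (LEAST n. n \<ge> N \<and> walk T f i n x \<in> S)"
        have "\<exists>n. n \<ge> N \<and> walk T f i n x \<in> S" using elim x by blast
        then have "n \<ge> N \<and> walk T f i n x \<in> S" unfolding n_def by (rule LeastI_ex)
        moreover have "walk T f i m x \<notin> S" if "N \<le> m" "m < n" for m
          using that not_less_Least[of m "\<lambda>n. n \<ge> N \<and> walk T f i n x \<in> S"] by (auto simp: n_def)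
        ultimately have "hit n x" by (auto simp: hit_def)
        then have "cyl n x \<in> \<C>" using x by (auto simp: \<C>_def)
        then show "x \<in> E i \<inter> \<Union>\<C>" using x cyl_self N0(2) by blast
      qed
    qed
    then have "measure M (E i \<inter> B) \<le> measure M (E i \<inter> \<Union>\<C>)"
      using EM UC by (intro finite_measure_mono_AE) auto
    also have "\<dots> \<le> q * measure M (\<Union>\<C>)"
    proof (rule measure_Int_Union_le[OF cC CM dC EM q(1)])
      fix c assume "c \<in> \<C>"
      then obtain n x where "c = cyl n x" "x \<in> B" "hit n x" by (auto simp: \<C>_def)
      then show "measure M (E i \<inter> c) \<le> q * measure M c"
        using cyl_le[of x n] N0(2) by (auto simp: hit_def N_def)
    qed
    also have "\<dots> \<le> q * measure M B"
      using q UCB BM by (intro mult_left_mono finite_measure_mono) auto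
    finally show ?thesis .
  qed
  show ?thesis
  proof (rule ccontr)
    assume "measure M (E i) \<noteq> 0"
    then have pos: "measure M (E i) > 0" by (simp add: zero_less_measure_iff)
    \<comment> \<open>With \<open>B\<close> within \<epsilon> of \<open>E i\<close>, the bound for
      \<open>B\<close> gives \<open>E i\<close> measure at most \<open>q * measure M (E i)\<close>
      plus 2 \<epsilon>; this choice makes 2 \<epsilon> half of the gap
      \<open>(1 - q) * measure M (E i)\<close>.\<close>
    define \<epsilon> where "\<epsilon> = (1 - q) * measure M (E i) / 4"
    have \<epsilon>: "\<epsilon> > 0" using q pos by (simp add: \<epsilon>_def)
    have "E i \<in> sigma_sets (space M) cyl_algebra"
      using E by (simp add: skew_invariant_def sets_cyl_measure)
    then obtain B where B: "B \<in> cyl_algebra" "measure M ((E i - B) \<union> (B - E i)) < \<epsilon>"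
      using approximate_by_algebra[OF algebra_cyl_algebra cyl_algebra_sets _ \<epsilon>] by blast
    have BM: "B \<in> sets M" using B cyl_algebra_sets by blast
    have d: "measure M (E i - B) \<le> \<epsilon>" "measure M (B - E i) \<le> \<epsilon>"
      using B(2) finite_measure_mono[of "E i - B" "(E i - B) \<union> (B - E i)"]
        finite_measure_mono[of "B - E i" "(E i - B) \<union> (B - E i)"] BM EM by auto
    have e1: "measure M (E i) = measure M (E i \<inter> B) + measure M (E i - B)"
      using finite_measure_Diff'[OF EM BM] by simp
    have e2: "measure M B = measure M (E i \<inter> B) + measure M (B - E i)"
      using finite_measure_Diff'[OF BM EM] by (simp add: Int_commute)
    have "measure M B \<le> measure M (E i) + \<epsilon>" using e1 e2 d by (smt (verit) measure_nonneg)
    then have "q * measure M B \<le> q * (measure M (E i) + \<epsilon>)" using q by (intro mult_left_mono)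
    also have "\<dots> \<le> q * measure M (E i) + \<epsilon>" using q \<epsilon> by (simp add: distrib_left mult_left_le_one_le)
    finally have "measure M (E i) \<le> q * measure M (E i) + 2 * \<epsilon>"
      using alg_le[OF B(1)] e1 d by linarith
    then show False using pos q by (simp add: \<epsilon>_def field_simps)
  qed
qed

end

section \<open>Transport along links\<close>

context base_map
begin

lemma cell_nonempty: "b \<in> \<beta> \<Longrightarrow> b \<noteq> {}"
  using markov by (auto simp: markov_partition_def partition_on_def)

lemma cyl_one: "x \<in> space M \<Longrightarrow> b \<in> \<beta> \<Longrightarrow> x \<in> b \<Longrightarrow> cyl (Suc 0) x = b"
  using cyl_image[of x b 0] by simp

text \<open>Continuity from below along an enumeration. It reduces a possibly infinite partition to
  finitely many cells, whose positive measures have a positive minimum.\<close>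

lemma finite_cells_cover:
  assumes "0 < (\<tau>::real)"
  obtains F where "finite F" "F \<subseteq> \<beta>" "measure M (space M - \<Union>F) < \<tau>"
proof -
  define u where "u n = \<Union>(from_nat_into \<beta> ` {..<n})" for n
  have cell: "from_nat_into \<beta> n \<in> \<beta>" for n using cells_nonempty by (rule from_nat_into)
  then have uM: "u n \<in> sets M" for n unfolding u_def using cell_sets by auto
  have inc: "incseq u" by (force simp: u_def incseq_def)
  have "(\<Union>n. u n) = space M"
  proof -
    have "(\<Union>n. u n) = \<Union>(range (from_nat_into \<beta>))" by (auto simp: u_def)
    then show ?thesis
      using range_from_nat_into[OF cells_nonempty countable_cells] Union_cells by simp
  qed
  then have "(\<lambda>n. measure M (u n)) \<longlonglongrightarrow> 1"
    using finite_Lim_measure_incseq[of u] uM inc prob_space by (simp add: image_subset_iff)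
  then have "\<forall>\<^sub>F n in sequentially. 1 - \<tau> < measure M (u n)"
    using assms by (intro order_tendstoD) auto
  then obtain n where n: "1 - \<tau> < measure M (u n)" by (auto simp: eventually_sequentially)
  show thesis
  proof
    show "finite (from_nat_into \<beta> ` {..<n})" "from_nat_into \<beta> ` {..<n} \<subseteq> \<beta>" using cell by auto
    show "measure M (space M - \<Union>(from_nat_into \<beta> ` {..<n})) < \<tau>"
      using n prob_compl[OF uM[of n]] by (simp add: u_def)
  qed
qed

text \<open>The first cell of a skew cylinder fixes the state, and all its cells together fix the
  itinerary. So a lower bound on the measure of a linking cylinder becomes one for a cylinder of
  \<open>T\<close>.\<close>

lemma skew_cylinder_subset:
  assumes c: "c \<in> cylinders (skew T f) (skew_partition \<beta>) n" and n: "n \<ge> 1" and y: "(y, i) \<in> c"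
  shows "y \<in> space M" "c \<subseteq> cyl n y \<times> {i}"
proof -
  obtain A where A: "c = (\<Inter>l<n. (skew T f ^^ l) -` A l)" "\<forall>l<n. A l \<in> skew_partition \<beta>"
    using c by (auto simp: cylinders_def)
  have "\<exists>b k. b \<in> \<beta> \<and> A l = b \<times> {k}" if "l < n" for l
    using A(2) that unfolding skew_partition_def by blast
  then obtain b k where bk: "\<And>l. l < n \<Longrightarrow> b l \<in> \<beta>" "\<And>l. l < n \<Longrightarrow> A l = b l \<times> {k l}"
    by metis
  have mem: "(T ^^ l) z \<in> b l \<and> walk T f j l z = k l" if "(z, j) \<in> c" "l < n" for z j l
  proof -
    have "(skew T f ^^ l) (z, j) \<in> A l" using A(1) that by blast
    then show ?thesis using bk(2)[OF that(2)] by (simp add: skew_power)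
  qed
  have space: "z \<in> space M" if "(z, j) \<in> c" for z j
    using mem[OF that, of 0] bk(1)[of 0] n cell_subset by auto
  show "y \<in> space M" using space y .
  show "c \<subseteq> cyl n y \<times> {i}"
  proof
    fix p assume "p \<in> c"
    then obtain z j where p: "p = (z, j)" "(z, j) \<in> c" by (cases p) auto
    have "j = i" using mem[OF p(2), of 0] mem[OF y, of 0] n by simp
    moreover have "(T ^^ l) y \<in> a \<longleftrightarrow> (T ^^ l) z \<in> a" if "l < n" "a \<in> \<beta>" for l a
      using mem[OF p(2) that(1)] mem[OF y that(1)] bk(1)[OF that(1)] that(2) cell_unique by metis
    ultimately show "p \<in> cyl n y \<times> {i}" using p space by (auto simp: cyl_def agree_def)
  qed
qed

lemma agree_Suc_shift:
  assumes "b \<in> \<beta>" "x \<in> b" "z \<in> b" "agree n (T x) (T z)"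
  shows "agree (Suc n) x z"
  unfolding agree_def
proof (intro allI impI ballI)
  fix j a assume ja: "j < Suc n" "a \<in> \<beta>"
  show "(T ^^ j) x \<in> a \<longleftrightarrow> (T ^^ j) z \<in> a"
  proof (cases j)
    case 0
    then show ?thesis using assms(1-3) ja(2) cell_unique by (metis funpow_0)
  next
    case (Suc l)
    then have "l < n" using ja by simp
    then have "(T ^^ l) (T x) \<in> a \<longleftrightarrow> (T ^^ l) (T z) \<in> a"
      using assms(4) ja(2) by (simp add: agree_def)
    then show ?thesis using Suc by (simp add: funpow_swap1)
  qed
qed

text \<open>Mass missing from the family at \<open>j\<close> is also missing at \<open>i\<close>:
  along a linking cylinder inside \<open>b\<close>, escape at \<open>j\<close> is pulled back to
  escape at \<open>i\<close>. In the linked case distortion is used twice, for the measure of that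
  cylinder and for the pullback, which gives the square of \<open>D\<close>. The cell
  \<open>a\<close> is the one visited just before \<open>b'\<close>.\<close>

lemma linked_bound:
  assumes f: "cell_const f" and E: "skew_invariant f E" and lnk: "linked M T \<beta> f r" and r: "r > 0"
    and dist: "distortion_bound D"
    and ij: "\<bar>i - j\<bar> = 1" and b: "b \<in> \<beta>" and b': "b' \<in> \<beta>"
  shows "\<exists>a\<in>\<beta>. b' \<subseteq> T ` a \<and>
    min r 1 * (measure M b * measure M (T ` a - E j)) \<le> D\<^sup>2 * measure M (b - E i)"
proof -
  note D = distortion_boundD[OF dist]
  have bM: "b \<in> sets M" using cell_sets[OF b] .
  consider (direct) "b' \<times> {j} \<subseteq> skew T f ` (b \<times> {i})"
    | (link) n c where "n \<ge> 1" "c \<in> cylinders (skew T f) (skew_partition \<beta>) n"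
        "emeasure (skew_measure M) c \<ge> ennreal r"
        "emeasure (skew_measure M)
          (b \<times> {i} \<inter> skew T f -` (c \<inter> (skew T f ^^ n) -` (b' \<times> {j}))) > 0"
    using lnk b b' ij unfolding linked_def by metis
  then show ?thesis
  proof cases
    case direct
    obtain x' where "x' \<in> b'" using cell_nonempty[OF b'] by blast
    then obtain x where x: "x \<in> b" "T x \<in> b'" "j = i + f i x"
      using direct by (force simp: skew_def)
    have xs: "x \<in> space M" using x cell_subset b by blast
    have w: "walk T f i (Suc 0) x = j" using x by (simp add: walk_Suc)
    have sub: "b' \<subseteq> T ` b" by (rule cell_subset_image[of b b' "T x"]) (use b b' x in auto)
    have le: "measure M b * measure M (T ` b - E j) \<le> D * measure M (b - E i)"
      using skew_invariant_escape[OF f E dist xs b, of 0 i] x cyl_one[OF xs b] w by simp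
    have "min r 1 * (measure M b * measure M (T ` b - E j)) \<le> 1 * (measure M b * measure M (T ` b - E j))"
      by (intro mult_right_mono) auto
    also have "\<dots> \<le> D * measure M (b - E i)" using le by simp
    also have "\<dots> \<le> D\<^sup>2 * measure M (b - E i)"
      using D(1) by (intro mult_right_mono) (auto simp: power2_eq_square)
    finally show ?thesis using b sub by blast
  next
    case link
    then have "b \<times> {i} \<inter> skew T f -` (c \<inter> (skew T f ^^ n) -` (b' \<times> {j})) \<noteq> {}"
      by (metis emeasure_empty less_numeral_extra(3))
    then obtain p where p: "p \<in> b \<times> {i}" "skew T f p \<in> c" "(skew T f ^^ n) (skew T f p) \<in> b' \<times> {j}"
      by (meson IntE equals0I vimageE)
    then obtain x where "p = (x, i)" and x: "x \<in> b" by auto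
    then have x: "x \<in> b" "skew T f (x, i) \<in> c" "(skew T f ^^ n) (skew T f (x, i)) \<in> b' \<times> {j}"
      using p by auto
    have xs: "x \<in> space M" using x cell_subset b by blast
    \<comment> \<open>\<open>x\<close> is a point of \<open>b\<close> following the link: its image
      (y, k) lies in \<open>c\<close>, and \<open>n\<close> steps later the walk is in
      \<open>b'\<close> at state \<open>j\<close>.\<close>
    define y where "y = T x"
    define k where "k = i + f i x"
    have s: "skew T f (x, i) = (y, k)" by (simp add: skew_def y_def k_def)
    have c: "y \<in> space M" "c \<subseteq> cyl n y \<times> {k}"
      using skew_cylinder_subset[OF link(2,1), of y k] x(2) s by auto
    have y': "(T ^^ n) y \<in> b'" "walk T f k n y = j" using x(3) by (auto simp: s skew_power)
    have w: "walk T f i (Suc n) x = j" using y'(2) by (simp only: walk_Suc_shift y_def k_def)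
    have "ennreal r \<le> emeasure (skew_measure M) (cyl n y \<times> {k})"
      using link(3) c(2) cyl_sets[OF c(1), of n]
      by (intro order_trans[OF link(3)] emeasure_mono) (auto simp: skew_measure_def)
    also have "\<dots> = emeasure M (cyl n y) * emeasure (count_space UNIV) {k}"
    proof -
      interpret Z: sigma_finite_measure "count_space (UNIV :: int set)"
        by (rule sigma_finite_measure_count_space)
      show ?thesis unfolding skew_measure_def
        using cyl_sets[OF c(1)] by (intro Z.emeasure_pair_measure_Times) auto
    qed
    finally have rle: "r \<le> measure M (cyl n y)" by (simp add: emeasure_eq_measure)
    obtain a0 where a0: "a0 \<in> \<beta>" "y \<in> a0" using c(1) cell_of_point by blast
    \<comment> \<open>As \<open>n \<ge> 1\<close>, the cylinder of \<open>y\<close> lies in the cell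
      of \<open>y\<close>, which T(b) contains by the Markov property; so the distortion bound for
      \<open>b\<close> sees all of it.\<close>
    have "cyl n y \<subseteq> T ` b"
    proof -
      have "cyl n y \<subseteq> a0" using cyl_antimono[of "Suc 0" n y] cyl_one[OF c(1) a0] link(1) by simp
      also have "a0 \<subseteq> T ` b" by (rule cell_subset_image[of b a0 y]) (use a0 b x in \<open>auto simp: y_def\<close>)
      finally show ?thesis .
    qed
    then have "measure M b * measure M (cyl n y) \<le> D * measure M (b \<inter> T -` cyl n y)"
      using D(2)[OF xs b, of 0 "cyl n y"] x(1) cyl_sets[OF c(1), of n] cyl_one[OF xs b]
      by (simp add: Int_absorb2)
    also have "\<dots> \<le> D * measure M (cyl (Suc n) x)"
    proof -
      have "b \<inter> T -` cyl n y \<subseteq> cyl (Suc n) x"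
        using agree_Suc_shift[OF b x(1)] cell_subset[OF b] by (auto simp: cyl_def y_def)
      then show ?thesis using D(1) cyl_sets[OF xs] by (intro mult_left_mono finite_measure_mono) auto
    qed
    finally have m1: "measure M b * measure M (cyl n y) \<le> D * measure M (cyl (Suc n) x)" .
    obtain a where a: "a \<in> \<beta>" "(T ^^ n) x \<in> a" using T_power_in_space[OF xs] cell_of_point by metis
    have Tn: "T ((T ^^ n) x) = (T ^^ n) y" by (simp add: y_def funpow_swap1)
    have sub: "b' \<subseteq> T ` a"
      by (rule cell_subset_image[of a b' "(T ^^ n) y"]) (use a b' y' Tn[symmetric] in auto)
    have "cyl (Suc n) x \<subseteq> b" using cyl_antimono[of "Suc 0" "Suc n" x] cyl_one[OF xs b x(1)] by simp
    then have "D * measure M (cyl (Suc n) x - E i) \<le> D * measure M (b - E i)"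
      using bM skew_invariant_sets[OF E] D(1) by (intro mult_left_mono finite_measure_mono) auto
    then have m2: "measure M (cyl (Suc n) x) * measure M (T ` a - E j) \<le> D * measure M (b - E i)"
      using skew_invariant_escape[OF f E dist xs a, of i] w by simp
    have "min r 1 * (measure M b * measure M (T ` a - E j))
        \<le> measure M (cyl n y) * (measure M b * measure M (T ` a - E j))"
      using rle by (intro mult_right_mono) auto
    also have "\<dots> = measure M b * measure M (cyl n y) * measure M (T ` a - E j)" by simp
    also have "\<dots> \<le> D * measure M (cyl (Suc n) x) * measure M (T ` a - E j)"
      using m1 by (intro mult_right_mono) auto
    also have "\<dots> = D * (measure M (cyl (Suc n) x) * measure M (T ` a - E j))" by simp
    also have "\<dots> \<le> D * (D * measure M (b - E i))"
      using m2 D(1) by (intro mult_left_mono) auto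
    also have "\<dots> = D\<^sup>2 * measure M (b - E i)" by (simp add: power2_eq_square)
    finally show ?thesis using sub a by blast
  qed
qed

text \<open>A finite set \<open>F\<close> of cells carries nearly all the mass. Since T(a) has mass
  at least \<delta>, it contains some \<open>b\<close> of positive measure in \<open>F\<close>;
  \<open>E i\<close> nearly fills \<open>b\<close>, and \<open>linked_bound\<close> passes this on
  to every cell of \<open>F\<close> at \<open>j\<close>. The choice of \<epsilon> involves only
  \<open>F\<close>, \<open>r\<close>, \<open>D\<close> and \<open>e\<close>, hence is uniform in the
  environment and the states.\<close>

lemma transport_step:
  assumes r: "r > 0" and e: "e > 0"
  shows "\<exists>\<epsilon>>0. \<forall>f E i j. cell_const f \<longrightarrow> linked M T \<beta> f r \<longrightarrow> skew_invariant f E \<longrightarrow> \<bar>i - j\<bar> = 1 \<longrightarrow>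
    (\<exists>a\<in>\<beta>. measure M (T ` a - E i) < \<epsilon>) \<longrightarrow> measure M (space M - E j) < e"
proof -
  obtain D where dist: "distortion_bound D" using distortion by blast
  then have D: "D \<ge> 1" by (rule distortion_boundD)
  obtain \<delta> where \<delta>: "\<delta> > 0" "\<And>a. a \<in> \<beta> \<Longrightarrow> \<delta> \<le> measure M (T ` a)"
    using image_measure_bound by blast
  obtain F where F: "finite F" "F \<subseteq> \<beta>" "measure M (space M - \<Union>F) < min \<delta> (e / 2)"
    using finite_cells_cover[of "min \<delta> (e / 2)"] \<delta> e by auto
  have UF: "\<Union>F \<in> sets M" using F cell_sets by (intro sets.finite_Union) auto
  \<comment> \<open>A lower bound for the mass of the cell from which the links start; the inserted
    1 guards against an empty set of measures.\<close>
  define \<kappa> where "\<kappa> = Min (insert 1 (measure M ` {b \<in> F. measure M b > 0}))"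
  have \<kappa>: "\<kappa> > 0" using F(1) by (auto simp: \<kappa>_def)
  have \<kappa>_le: "\<kappa> \<le> measure M b" if "b \<in> F" "measure M b > 0" for b
    using that F(1) by (auto simp: \<kappa>_def)
  define K where "K = min r 1 * \<kappa> / D\<^sup>2"
  have K: "K > 0" using r \<kappa> D by (simp add: K_def)
  \<comment> \<open>By \<open>linked_bound\<close>, each cell of \<open>F\<close> misses at most
    \<epsilon> / K at \<open>j\<close>; dividing by \<open>card F + 1\<close> brings the sum over
    \<open>F\<close> to at most e / 2.\<close>
  define \<epsilon> where "\<epsilon> = K * (e / 2) / (card F + 1)"
  have \<epsilon>: "\<epsilon> > 0" using K e by (simp add: \<epsilon>_def)
  have "measure M (space M - E j) < e"
    if f: "cell_const f" and lnk: "linked M T \<beta> f r" and E: "skew_invariant f E"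
      and ij: "\<bar>i - j\<bar> = 1" and a: "a \<in> \<beta>" "measure M (T ` a - E i) < \<epsilon>" for f E i j a
  proof -
    have EM: "E l \<in> sets M" for l using skew_invariant_sets[OF E] .
    have TaM: "T ` a \<in> sets M" using cell_image_sets a by blast
    have "\<exists>b\<in>F. measure M (T ` a \<inter> b) > 0"
    proof (rule ccontr)
      assume "\<not> ?thesis"
      then have "measure M (T ` a \<inter> b) = 0" if "b \<in> F" for b
        using that by (metis measure_nonneg order_le_less)
      then have "measure M (\<Union>b\<in>F. T ` a \<inter> b) \<le> 0"
        using measure_UNION_le[OF F(1), of "\<lambda>b. T ` a \<inter> b" M] TaM F(2) cell_sets by auto
      then have z: "measure M (\<Union>b\<in>F. T ` a \<inter> b) = 0" by (simp add: measure_le_0_iff)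
      have "T ` a \<subseteq> (\<Union>b\<in>F. T ` a \<inter> b) \<union> (space M - \<Union>F)"
        using TaM sets.sets_into_space by blast
      then have "measure M (T ` a) \<le> measure M ((\<Union>b\<in>F. T ` a \<inter> b) \<union> (space M - \<Union>F))"
        using TaM UF F cell_sets by (intro finite_measure_mono) auto
      also have "\<dots> \<le> measure M (\<Union>b\<in>F. T ` a \<inter> b) + measure M (space M - \<Union>F)"
        using TaM UF F cell_sets by (intro measure_Un_le) auto
      finally show False using z F(3) \<delta>(2)[OF a(1)] by simp
    qed
    then obtain b where b: "b \<in> F" "measure M (T ` a \<inter> b) > 0" by blast
    have b\<beta>: "b \<in> \<beta>" using b F by blast
    have "T ` a \<inter> b \<noteq> {}" using b(2) by auto
    then have bTa: "b \<subseteq> T ` a" using cell_subset_image a(1) b\<beta> by blast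
    have mb: "\<kappa> \<le> measure M b"
      using b bTa by (intro \<kappa>_le) (auto simp: Int_absorb1)
    have "measure M (b - E i) \<le> measure M (T ` a - E i)"
      using bTa TaM EM by (intro finite_measure_mono) auto
    then have bi: "measure M (b - E i) < \<epsilon>" using a(2) by simp
    have each: "measure M (b' - E j) \<le> \<epsilon> / K" if b': "b' \<in> F" for b'
    proof -
      obtain a' where a': "a' \<in> \<beta>" "b' \<subseteq> T ` a'"
        "min r 1 * (measure M b * measure M (T ` a' - E j)) \<le> D\<^sup>2 * measure M (b - E i)"
        using linked_bound[OF f E lnk r dist ij b\<beta>, of b'] b' F(2) by blast
      have "measure M (b' - E j) \<le> measure M (T ` a' - E j)"
        using a' cell_image_sets EM by (intro finite_measure_mono) auto
      then have "min r 1 * (\<kappa> * measure M (b' - E j)) \<le> min r 1 * (measure M b * measure M (T ` a' - E j))"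
        using r mb \<kappa> by (intro mult_left_mono mult_mono) auto
      also have "\<dots> \<le> D\<^sup>2 * \<epsilon>" using a'(3) bi D by (meson less_imp_le mult_left_mono order_trans zero_le_power2)
      finally have "K * measure M (b' - E j) \<le> \<epsilon>" using D by (simp add: K_def field_simps)
      then show ?thesis using K by (simp add: field_simps)
    qed
    have "space M - E j \<subseteq> (\<Union>b'\<in>F. b' - E j) \<union> (space M - \<Union>F)" by blast
    then have "measure M (space M - E j) \<le> measure M ((\<Union>b'\<in>F. b' - E j) \<union> (space M - \<Union>F))"
      using EM UF F cell_sets by (intro finite_measure_mono) auto
    also have "\<dots> \<le> measure M (\<Union>b'\<in>F. b' - E j) + measure M (space M - \<Union>F)"
      using EM UF F cell_sets by (intro measure_Un_le) auto
    also have "measure M (\<Union>b'\<in>F. b' - E j) \<le> (\<Sum>b'\<in>F. measure M (b' - E j))"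
      using EM F cell_sets by (intro measure_UNION_le) auto
    also have "\<dots> \<le> (\<Sum>b'\<in>F. \<epsilon> / K)" using each by (intro sum_mono)
    also have "\<dots> = card F * (e / 2) / (card F + 1)" using K by (simp add: \<epsilon>_def)
    also have "\<dots> \<le> e / 2" using e by (simp add: field_simps)
    finally show ?thesis using F(3) by simp
  qed
  then show ?thesis using \<epsilon> by blast
qed

text \<open>Iterates \<open>transport_step\<close>: a family nearly filling the whole space nearly
  fills the image of any cell, so the conclusion of one step feeds the next.\<close>

lemma transport:
  assumes r: "r > 0" and e: "e > 0"
  shows "\<exists>\<epsilon>>0. \<forall>f E i j. cell_const f \<longrightarrow> linked M T \<beta> f r \<longrightarrow> skew_invariant f E \<longrightarrow> \<bar>i - j\<bar> \<le> int d \<longrightarrow>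
    (\<exists>a\<in>\<beta>. measure M (T ` a - E i) < \<epsilon>) \<longrightarrow> measure M (space M - E j) < e"
proof -
  have weaken: "\<exists>a\<in>\<beta>. measure M (T ` a - E i) < \<epsilon>"
    if E: "skew_invariant f E" "measure M (space M - E i) < \<epsilon>" for f E i \<epsilon>
  proof -
    obtain a where a: "a \<in> \<beta>" using cells_nonempty by blast
    have "measure M (T ` a - E i) \<le> measure M (space M - E i)"
      using sets.sets_into_space[OF cell_image_sets[OF a]] skew_invariant_sets[OF E(1)]
      by (intro finite_measure_mono) auto
    then show ?thesis using a E(2) by force
  qed
  show ?thesis
    using e
  proof (induction d arbitrary: e)
    case 0
    \<comment> \<open>Even at distance 0 something must be shown, as the hypothesis concerns one
      image and the conclusion the whole space: the path goes to \<open>i + 1\<close> and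
      back.\<close>
    obtain e1 where e1: "e1 > 0" "\<And>f E i j. cell_const f \<Longrightarrow> linked M T \<beta> f r \<Longrightarrow> skew_invariant f E \<Longrightarrow>
        \<bar>i - j\<bar> = 1 \<Longrightarrow> \<exists>a\<in>\<beta>. measure M (T ` a - E i) < e1 \<Longrightarrow> measure M (space M - E j) < e"
      using transport_step[OF r 0] by blast
    obtain e2 where e2: "e2 > 0" "\<And>f E i j. cell_const f \<Longrightarrow> linked M T \<beta> f r \<Longrightarrow> skew_invariant f E \<Longrightarrow>
      \<bar>i - j\<bar> = 1 \<Longrightarrow> \<exists>a\<in>\<beta>. measure M (T ` a - E i) < e2 \<Longrightarrow> measure M (space M - E j) < e1"
      using transport_step[OF r e1(1)] by blast
    have "measure M (space M - E i) < e"
      if "cell_const f" "linked M T \<beta> f r" "skew_invariant f E" "\<exists>a\<in>\<beta>. measure M (T ` a - E i) < e2"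
      for f E i
      using that e1(2)[of f E "i + 1" i] e2(2)[of f E i "i + 1"] weaken[of f E "i + 1" e1] by simp
    then show ?case using e2(1) by (intro exI[of _ e2]) auto
  next
    case (Suc d)
    obtain e1 where e1: "e1 > 0" "\<And>f E i j. cell_const f \<Longrightarrow> linked M T \<beta> f r \<Longrightarrow> skew_invariant f E \<Longrightarrow>
        \<bar>i - j\<bar> = 1 \<Longrightarrow> \<exists>a\<in>\<beta>. measure M (T ` a - E i) < e1 \<Longrightarrow> measure M (space M - E j) < e"
      using transport_step[OF r Suc.prems] by blast
    obtain d1 where d1: "d1 > 0" "\<And>f E i j. cell_const f \<Longrightarrow> linked M T \<beta> f r \<Longrightarrow> skew_invariant f E \<Longrightarrow>
      \<bar>i - j\<bar> \<le> int d \<Longrightarrow> \<exists>a\<in>\<beta>. measure M (T ` a - E i) < d1 \<Longrightarrow> measure M (space M - E j) < e"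
      using Suc.IH[OF Suc.prems] by blast
    obtain d2 where d2: "d2 > 0" "\<And>f E i j. cell_const f \<Longrightarrow> linked M T \<beta> f r \<Longrightarrow> skew_invariant f E \<Longrightarrow>
      \<bar>i - j\<bar> \<le> int d \<Longrightarrow> \<exists>a\<in>\<beta>. measure M (T ` a - E i) < d2 \<Longrightarrow> measure M (space M - E j) < e1"
      using Suc.IH[OF e1(1)] by blast
    have "measure M (space M - E j) < e"
      if *: "cell_const f" "linked M T \<beta> f r" "skew_invariant f E" and ij: "\<bar>i - j\<bar> \<le> int (Suc d)"
        and a: "a \<in> \<beta>" "measure M (T ` a - E i) < min d1 d2" for f E i j a
    proof (cases "\<bar>i - j\<bar> \<le> int d")
      case True
      then show ?thesis using d1(2)[OF * True] a by auto
    next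
      case False
      define k where "k = (if i < j then j - 1 else j + 1)"
      have k: "\<bar>i - k\<bar> \<le> int d" "\<bar>k - j\<bar> = 1" using False ij by (auto simp: k_def)
      have "measure M (space M - E k) < e1" using d2(2)[OF * k(1)] a by auto
      then show ?thesis using e1(2)[OF * k(2)] weaken[OF *(3)] by blast
    qed
    then show ?case using d1(1) d2(1) by (intro exI[of _ "min d1 d2"]) auto
  qed
qed

end

section \<open>Directions of the walk\<close>

text \<open>A step of size at most \<open>L\<close> cannot cross the band [-L, L] that the sequence
  avoids, so it stays above \<open>L\<close>; having also left each of the finitely many levels up
  to \<open>Z\<close>, it exceeds \<open>Z\<close>.\<close>

lemma int_seq_at_top:
  fixes u :: "nat \<Rightarrow> int"
  assumes step: "\<And>n. \<bar>u (Suc n) - u n\<bar> \<le> L" and leave: "\<And>k. \<forall>\<^sub>F n in sequentially. u n \<noteq> k"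
    and N: "\<And>n. n \<ge> N \<Longrightarrow> \<bar>u n\<bar> > L" "u N > L"
  shows "filterlim u at_top sequentially"
proof -
  have L: "L \<ge> 0" using step[of 0] by linarith
  have pos: "u n > L" if "n \<ge> N" for n
    using that
  proof (induction n rule: dec_induct)
    case (step n)
    then show ?case using assms(1)[of n] N(1)[of "Suc n"] L by linarith
  qed (rule N(2))
  show ?thesis unfolding filterlim_at_top
  proof
    fix Z
    have "\<forall>\<^sub>F n in sequentially. \<forall>k\<in>{L..Z}. u n \<noteq> k"
      using leave by (intro eventually_ball_finite) auto
    then show "\<forall>\<^sub>F n in sequentially. Z \<le> u n"
      using eventually_ge_at_top[of N]
    proof eventually_elim
      case (elim n)
      then show ?case using pos[of n] by (cases "u n \<le> Z") force+
    qed
  qed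
qed

text \<open>The finitely many levels in [-L, L] are all left for good, and the side on which the
  sequence then finds itself decides the limit; a change of sign reduces the negative side to the
  positive one.\<close>

lemma int_seq_at_top_or_at_bot:
  fixes u :: "nat \<Rightarrow> int"
  assumes step: "\<And>n. \<bar>u (Suc n) - u n\<bar> \<le> L" and leave: "\<And>k. \<forall>\<^sub>F n in sequentially. u n \<noteq> k"
  shows "filterlim u at_top sequentially \<or> filterlim u at_bot sequentially"
proof -
  have "\<forall>\<^sub>F n in sequentially. \<forall>k\<in>{-L..L}. u n \<noteq> k"
    using leave by (intro eventually_ball_finite) auto
  then obtain N where "\<And>n. n \<ge> N \<Longrightarrow> \<forall>k\<in>{-L..L}. u n \<noteq> k" unfolding eventually_sequentially by blast
  then have N: "\<bar>u n\<bar> > L" if "n \<ge> N" for n using that by (metis abs_le_D1 abs_le_D2 atLeastAtMost_iff linorder_not_less minus_le_iff)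
  show ?thesis
  proof (cases "u N > L")
    case True
    then show ?thesis using int_seq_at_top[OF assms N] by blast
  next
    case False
    have "filterlim (\<lambda>n. - u n) at_top sequentially"
    proof (rule int_seq_at_top[where L = L and N = N])
      show "\<bar>- u (Suc n) - - u n\<bar> \<le> L" for n using step[of n] by linarith
      show "\<forall>\<^sub>F n in sequentially. - u n \<noteq> k" for k
        using leave[of "- k"] by eventually_elim auto
      show "\<bar>- u n\<bar> > L" if "n \<ge> N" for n using N[OF that] by simp
      show "- u N > L" using N[of N] False by linarith
    qed
    then have "\<forall>\<^sub>F n in sequentially. - Z \<le> - u n" for Z unfolding filterlim_at_top by blast
    then show ?thesis by (simp add: filterlim_at_bot)
  qed
qed

text \<open>At the first time from \<open>N\<close> on at which the sequence is at most
  \<open>j\<close>, it has dropped by at most \<open>L\<close> from a value above \<open>j\<close>,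
  unless that time is \<open>N\<close> itself.\<close>

lemma int_seq_crossing:
  fixes u :: "nat \<Rightarrow> int"
  assumes step: "\<And>n. \<bar>u (Suc n) - u n\<bar> \<le> L" and lim: "filterlim u at_bot sequentially"
    and "j \<le> u N"
  shows "\<exists>n\<ge>N. \<bar>u n - j\<bar> \<le> L"
proof -
  have L: "L \<ge> 0" using step[of 0] by linarith
  have "\<forall>\<^sub>F n in sequentially. u n \<le> j" using lim by (simp add: filterlim_at_bot)
  then have "\<exists>n. n \<ge> N \<and> u n \<le> j" unfolding eventually_sequentially by (meson nat_le_linear)
  define n where "n = (LEAST n. n \<ge> N \<and> u n \<le> j)"
  have n: "n \<ge> N" "u n \<le> j"
    using LeastI_ex[OF \<open>\<exists>n. n \<ge> N \<and> u n \<le> j\<close>] unfolding n_def by auto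
  have "u n \<ge> j - L"
  proof (cases "n = N")
    case True
    then show ?thesis using assms(3) L by simp
  next
    case False
    then obtain m where m: "n = Suc m" "m \<ge> N" using n(1) by (cases n) auto
    then have "\<not> u m \<le> j" using not_less_Least[of m "\<lambda>n. n \<ge> N \<and> u n \<le> j"] by (auto simp: n_def)
    then show ?thesis using step[of m] m by simp
  qed
  then show ?thesis using n L by (intro exI[of _ n]) auto
qed

context base_map
begin

section \<open>Starting points with a limit or with infinitely many visits\<close>

definition up :: "(int \<Rightarrow> 'a \<Rightarrow> int) \<Rightarrow> int \<Rightarrow> 'a set" where
  "up f i = {x \<in> space M. filterlim (\<lambda>n. walk T f i n x) at_top sequentially}"

definition down :: "(int \<Rightarrow> 'a \<Rightarrow> int) \<Rightarrow> int \<Rightarrow> 'a set" where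
  "down f i = {x \<in> space M. filterlim (\<lambda>n. walk T f i n x) at_bot sequentially}"

text \<open>The target \<open>k\<close> comes before the starting state, so that
  \<open>visits f k\<close> is a family indexed by states.\<close>

definition visits :: "(int \<Rightarrow> 'a \<Rightarrow> int) \<Rightarrow> int \<Rightarrow> int \<Rightarrow> 'a set" where
  "visits f k i = {x \<in> space M. \<exists>\<^sub>F n in sequentially. walk T f i n x = k}"

lemma T_in_space: "x \<in> space M \<Longrightarrow> T x \<in> space M"
  using T_power_in_space[of x 1] by simp

text \<open>A limit ignores the first term, and by \<open>walk_Suc_shift\<close> the walk of
  \<open>T x\<close> from \<open>i + f i x\<close> is that of \<open>x\<close> from \<open>i\<close>
  with its first term dropped. Countable quantifiers give measurability.\<close>

lemma skew_invariant_up: assumes f: "cell_const f" shows "skew_invariant f (up f)"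
  unfolding skew_invariant_def
proof (intro conjI allI ballI)
  fix i
  note [measurable] = walk_cyl_measurable[OF f]
  have eq: "up f i = {x \<in> space cyl_measure. \<forall>Z. \<exists>N. \<forall>n\<ge>N. Z \<le> walk T f i n x}"
    by (simp add: up_def filterlim_at_top eventually_sequentially)
  show "up f i \<in> sets cyl_measure" unfolding eq by measurable
  fix x assume "x \<in> space M"
  then show "x \<in> up f i \<longleftrightarrow> T x \<in> up f (i + f i x)"
    unfolding up_def using T_in_space
    by (simp add: walk_Suc_shift[symmetric] filterlim_sequentially_Suc[of "\<lambda>n. walk T f i n x"])
qed

lemma skew_invariant_down: assumes f: "cell_const f" shows "skew_invariant f (down f)"
  unfolding skew_invariant_def
proof (intro conjI allI ballI)
  fix i
  note [measurable] = walk_cyl_measurable[OF f]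
  have eq: "down f i = {x \<in> space cyl_measure. \<forall>Z. \<exists>N. \<forall>n\<ge>N. Z \<ge> walk T f i n x}"
    by (simp add: down_def filterlim_at_bot eventually_sequentially)
  show "down f i \<in> sets cyl_measure" unfolding eq by measurable
  fix x assume "x \<in> space M"
  then show "x \<in> down f i \<longleftrightarrow> T x \<in> down f (i + f i x)"
    unfolding down_def using T_in_space
    by (simp add: walk_Suc_shift[symmetric] filterlim_sequentially_Suc[of "\<lambda>n. walk T f i n x"])
qed

lemma skew_invariant_visits: assumes f: "cell_const f" shows "skew_invariant f (visits f k)"
  unfolding skew_invariant_def
proof (intro conjI allI ballI)
  fix i
  note [measurable] = walk_cyl_measurable[OF f]
  have eq: "visits f k i = {x \<in> space cyl_measure. \<forall>N. \<exists>n\<ge>N. walk T f i n x = k}"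
    by (simp add: visits_def frequently_sequentially)
  show "visits f k i \<in> sets cyl_measure" unfolding eq by measurable
  fix x assume "x \<in> space M"
  then show "x \<in> visits f k i \<longleftrightarrow> T x \<in> visits f k (i + f i x)"
    unfolding visits_def frequently_def using T_in_space
    by (simp add: walk_Suc_shift[symmetric] eventually_sequentially_Suc[of "\<lambda>n. walk T f i n x \<noteq> k"])
qed

text \<open>If \<open>visits f k k\<close> misses a fixed amount of every image,
  \<open>skew_invariant_null\<close> applies with \<open>S = {k}\<close>. Otherwise it nearly fills
  some image to every precision, and transport at distance 0 makes it full, so that \<open>k\<close>
  would be recurrent.\<close>

lemma visits_null:
  assumes f: "cell_const f" and lnk: "linked M T \<beta> f r" and r: "r > 0"
    and trans: "\<not> recurrent_state M T f k"
  shows "measure M (visits f k i) = 0"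
proof (cases "\<exists>\<kappa>>0. \<forall>a\<in>\<beta>. \<kappa> \<le> measure M (T ` a - visits f k k)")
  case True
  then obtain \<kappa> where \<kappa>: "\<kappa> > 0" "\<And>a. a \<in> \<beta> \<Longrightarrow> \<kappa> \<le> measure M (T ` a - visits f k k)" by blast
  show ?thesis
    by (rule skew_invariant_null[OF f skew_invariant_visits[OF f] \<kappa>(1), where S = "{k}"])
      (use \<kappa>(2) in \<open>auto simp: visits_def frequently_sequentially\<close>)
next
  case False
  note V = skew_invariant_visits[OF f, of k]
  have VM: "visits f k k \<in> sets M" using skew_invariant_sets[OF V] .
  have "measure M (space M - visits f k k) < e" if e: "e > 0" for e
  proof -
    obtain \<epsilon> where \<epsilon>: "\<epsilon> > 0" "\<exists>a\<in>\<beta>. measure M (T ` a - visits f k k) < \<epsilon> \<Longrightarrow>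
        measure M (space M - visits f k k) < e"
      using transport[OF r e, of 0] f lnk V by (metis abs_zero diff_self of_nat_0_le_iff)
    then show ?thesis using False by (meson linorder_not_less)
  qed
  then have "measure M (space M - visits f k k) = 0"
    by (metis linorder_neqE_linordered_idom measure_nonneg not_less order_less_irrefl)
  then have "measure M (visits f k k) = 1" using prob_compl[OF VM] by simp
  moreover have "measure M (visits f k k) \<le> measure M {x \<in> space M. \<exists>n\<ge>1. walk T f k n x = k}"
  proof (rule finite_measure_mono)
    have eq: "{x \<in> space M. \<exists>n\<ge>1. walk T f k n x = k} = {x \<in> space cyl_measure. \<exists>n\<ge>1. walk T f k n x = k}"
      by simp
    show "visits f k k \<subseteq> {x \<in> space M. \<exists>n\<ge>1. walk T f k n x = k}"
      by (auto simp: visits_def frequently_sequentially)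
    note [measurable] = walk_cyl_measurable[OF f]
    show "{x \<in> space M. \<exists>n\<ge>1. walk T f k n x = k} \<in> sets M"
      unfolding eq by (rule cyl_measure_sets) measurable
  qed
  ultimately have "recurrent_state M T f k"
    unfolding recurrent_state_def by (intro antisym prob_le_1) simp
  then show ?thesis using trans by blast
qed

lemma walk_step_bound:
  assumes "\<forall>i. \<forall>x\<in>space M. \<bar>f i x\<bar> \<le> L" "x \<in> space M"
  shows "\<bar>walk T f i (Suc n) x - walk T f i n x\<bar> \<le> L"
  using assms(1) T_power_in_space[OF assms(2)] by (simp add: walk_Suc)

lemma AE_up_or_down:
  assumes f: "cell_const f" and lnk: "linked M T \<beta> f r" and r: "r > 0"
    and jumps: "\<forall>i. \<forall>x\<in>space M. \<bar>f i x\<bar> \<le> L"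
    and trans: "\<And>k. \<not> recurrent_state M T f k"
  shows "AE x in M. x \<in> up f i \<or> x \<in> down f i"
proof -
  have "AE x in M. x \<notin> visits f k i" for k
  proof -
    have "visits f k i \<in> null_sets M"
      using skew_invariant_sets[OF skew_invariant_visits[OF f]] visits_null[OF f lnk r trans]
      by (intro null_setsI) (simp_all add: emeasure_eq_measure)
    then show ?thesis by (rule AE_not_in)
  qed
  then have "AE x in M. \<forall>k. x \<notin> visits f k i" by (simp add: AE_all_countable)
  then show ?thesis
  proof (rule AE_mp, intro AE_I2 impI)
    fix x assume x: "x \<in> space M" "\<forall>k. x \<notin> visits f k i"
    then have "\<forall>\<^sub>F n in sequentially. walk T f i n x \<noteq> k" for k
      by (simp add: visits_def frequently_def)
    then show "x \<in> up f i \<or> x \<in> down f i"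
      using int_seq_at_top_or_at_bot[of "\<lambda>n. walk T f i n x", OF walk_step_bound[OF jumps x(1)]] x(1)
      by (auto simp: up_def down_def)
  qed
qed

text \<open>Otherwise \<open>skew_invariant_null\<close> applies with \<open>S = UNIV\<close>, where
  the visiting condition is trivial.\<close>

lemma up_image_large:
  assumes f: "cell_const f" and pos: "measure M (up f i) > 0" and \<epsilon>: "\<epsilon> > 0"
  shows "\<exists>j. \<exists>a\<in>\<beta>. measure M (T ` a - up f j) < \<epsilon>"
proof (rule ccontr)
  assume "\<not> ?thesis"
  then have "measure M (up f i) = 0"
    by (intro skew_invariant_null[OF f skew_invariant_up[OF f] \<epsilon>, where S = UNIV]) (auto simp: not_less)
  then show False using pos by simp
qed

text \<open>A walk tending to -\<infinity> passes every \<open>j\<close> below it with steps of size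
  at most \<open>L\<close>, hence lands within \<open>L\<close> of it. By \<open>win\<close> it
  keeps visiting states where \<open>up\<close> is nearly full; there the disjoint set
  \<open>down\<close> misses at least \<delta> / 2 of every image.\<close>

lemma down_null:
  assumes f: "cell_const f" and jumps: "\<forall>i. \<forall>x\<in>space M. \<bar>f i x\<bar> \<le> L"
    and \<delta>: "\<delta> > 0" "\<And>a. a \<in> \<beta> \<Longrightarrow> \<delta> \<le> measure M (T ` a)"
    and win: "\<And>N. \<exists>j\<le>N. \<forall>k. \<bar>k - j\<bar> \<le> L \<longrightarrow> measure M (space M - up f k) < \<delta> / 2"
  shows "measure M (down f i) = 0"
proof (rule skew_invariant_null[OF f skew_invariant_down[OF f],
      where \<kappa> = "\<delta> / 2" and S = "{k. measure M (space M - up f k) < \<delta> / 2}"])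
  show "\<delta> / 2 > 0" using \<delta> by simp
  have upM: "up f k \<in> sets M" for k using skew_invariant_sets[OF skew_invariant_up[OF f]] .
  have downM: "down f k \<in> sets M" for k using skew_invariant_sets[OF skew_invariant_down[OF f]] .
  have disj: "up f k \<inter> down f k = {}" for k
  proof -
    have False if "filterlim u at_top sequentially" "filterlim u at_bot sequentially" for u :: "nat \<Rightarrow> int"
    proof -
      have "\<forall>\<^sub>F n in sequentially. u n \<ge> 1" "\<forall>\<^sub>F n in sequentially. u n \<le> 0"
        using that by (simp_all add: filterlim_at_top filterlim_at_bot)
      then have "\<forall>\<^sub>F n in sequentially. False" by eventually_elim auto
      then show False by simp
    qed
    then show ?thesis by (auto simp: up_def down_def)
  qed
  fix k a assume k: "k \<in> {k. measure M (space M - up f k) < \<delta> / 2}" and a: "a \<in> \<beta>"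
  have TaM: "T ` a \<in> sets M" using cell_image_sets[OF a] .
  have "T ` a \<subseteq> (T ` a - down f k) \<union> (space M - up f k)"
    using disj[of k] sets.sets_into_space[OF TaM] by blast
  then have "measure M (T ` a) \<le> measure M ((T ` a - down f k) \<union> (space M - up f k))"
    using TaM upM downM by (intro finite_measure_mono) auto
  also have "\<dots> \<le> measure M (T ` a - down f k) + measure M (space M - up f k)"
    using TaM upM downM by (intro measure_Un_le) auto
  finally show "\<delta> / 2 \<le> measure M (T ` a - down f k)" using k \<delta>(2)[OF a] by simp
next
  show "AE x in M. x \<in> down f i \<longrightarrow>
    (\<forall>N. \<exists>n\<ge>N. walk T f i n x \<in> {k. measure M (space M - up f k) < \<delta> / 2})"
  proof (intro AE_I2 impI allI)
    fix x N assume x: "x \<in> space M" "x \<in> down f i"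
    obtain j where j: "j \<le> walk T f i N x"
        "\<forall>k. \<bar>k - j\<bar> \<le> L \<longrightarrow> measure M (space M - up f k) < \<delta> / 2"
      using win by blast
    have "filterlim (\<lambda>n. walk T f i n x) at_bot sequentially" using x by (simp add: down_def)
    from int_seq_crossing[of "\<lambda>n. walk T f i n x", OF walk_step_bound[OF jumps x(1)] this j(1)]
    show "\<exists>n\<ge>N. walk T f i n x \<in> {k. measure M (space M - up f k) < \<delta> / 2}" using j(2) by blast
  qed
qed

end

section \<open>The random environment\<close>

context dwde
begin

section \<open>The two-sided shift of environments\<close>

abbreviation sh :: "int \<Rightarrow> 'w \<Rightarrow> 'w" where
  "sh \<equiv> iterate_int P \<eta>"

abbreviation \<theta> :: "'w \<Rightarrow> 'w" where
  "\<theta> \<equiv> the_inv_into (space P) \<eta>"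

lemma eta_measurable: "\<eta> \<in> P \<rightarrow>\<^sub>M P" and theta_measurable: "\<theta> \<in> P \<rightarrow>\<^sub>M P"
  and bij_eta: "bij_betw \<eta> (space P) (space P)"
  using invertible by (simp_all add: invertible_transformation_def)

lemma eta_theta: "\<omega> \<in> space P \<Longrightarrow> \<eta> (\<theta> \<omega>) = \<omega>"
  using bij_eta by (intro f_the_inv_into_f_bij_betw) auto

lemma theta_eta: "\<omega> \<in> space P \<Longrightarrow> \<theta> (\<eta> \<omega>) = \<omega>"
  using bij_eta by (intro the_inv_into_f_f) (auto simp: bij_betw_def)

lemma sh_measurable [measurable]: "sh i \<in> P \<rightarrow>\<^sub>M P"
  unfolding iterate_int_def using eta_measurable theta_measurable
  by (simp add: measurable_compose_n)

lemma sh_in_space: "\<omega> \<in> space P \<Longrightarrow> sh i \<omega> \<in> space P"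
  using measurable_space[OF sh_measurable] .

lemma sh_0 [simp]: "sh 0 \<omega> = \<omega>"
  by (simp add: iterate_int_def)

lemma sh_Suc: assumes "\<omega> \<in> space P" shows "sh (i + 1) \<omega> = \<eta> (sh i \<omega>)"
proof (cases "i \<ge> 0")
  case True
  then have "nat (i + 1) = Suc (nat i)" by simp
  then show ?thesis using True by (simp add: iterate_int_def)
next
  case False
  define m where "m = nat (- i - 1)"
  have m: "nat (- i) = Suc m" "i + 1 = - int m" using False by (auto simp: m_def)
  have "(\<theta> ^^ m) \<omega> \<in> space P"
    using measurable_space[OF measurable_compose_n[OF theta_measurable] assms] .
  then have "\<eta> (sh i \<omega>) = (\<theta> ^^ m) \<omega>" using False m by (simp add: iterate_int_def eta_theta)
  moreover have "sh (i + 1) \<omega> = (\<theta> ^^ m) \<omega>"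
    unfolding m(2) by (cases "m = 0") (auto simp: iterate_int_def)
  ultimately show ?thesis by simp
qed

lemma sh_add: assumes "\<omega> \<in> space P" shows "sh (i + j) \<omega> = sh i (sh j \<omega>)"
proof (induction i rule: int_induct[where k = 0])
  case base
  then show ?case by simp
next
  case (step1 i)
  have "sh (i + 1 + j) \<omega> = \<eta> (sh (i + j) \<omega>)"
    using sh_Suc[OF assms, of "i + j"] by (simp add: ac_simps)
  then show ?case using step1 sh_Suc[OF sh_in_space[OF assms]] by simp
next
  case (step2 i)
  have "\<eta> (sh (i - 1 + j) \<omega>) = sh (i + j) \<omega>"
    using sh_Suc[OF assms, of "i - 1 + j"] by (simp add: algebra_simps)
  also have "\<dots> = \<eta> (sh (i - 1) (sh j \<omega>))"
    using step2 sh_Suc[OF sh_in_space[OF assms], of "i - 1" j] by simp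
  finally show ?case
    using bij_eta sh_in_space assms by (meson bij_betw_imp_inj_on inj_onD)
qed

lemma sh_1: "\<omega> \<in> space P \<Longrightarrow> sh 1 \<omega> = \<eta> \<omega>"
  using sh_Suc[of \<omega> 0] by simp

lemma measure_sh_vimage:
  assumes st: "stationary_environment P \<eta>" and A: "A \<in> sets P"
  shows "measure P (sh i -` A \<inter> space P) = measure P A"
proof -
  have eta: "measure P (\<eta> -` A \<inter> space P) = measure P A" if "A \<in> sets P" for A
    using measure_distr[OF eta_measurable that] st by (simp add: stationary_environment_def)
  \<comment> \<open>Pulling back along \<eta> undoes pulling back along \<theta>, so invariance
    under \<theta> follows from that under \<eta>.\<close>
  have theta: "measure P (\<theta> -` A \<inter> space P) = measure P A" if A: "A \<in> sets P" for A
  proof -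
    have "\<eta> -` (\<theta> -` A \<inter> space P) \<inter> space P = A"
      using measurable_space[OF eta_measurable] theta_eta sets.sets_into_space[OF A] by auto
    then show ?thesis using eta[OF measurable_sets[OF theta_measurable A]] by simp
  qed
  show ?thesis
    using A
  proof (induction i arbitrary: A rule: int_induct[where k = 0])
    case base
    then show ?case using sets.sets_into_space by (simp add: Int_absorb2)
  next
    case (step1 i)
    have "sh (i + 1) -` A \<inter> space P = sh i -` (\<eta> -` A \<inter> space P) \<inter> space P"
      using sh_Suc sh_in_space by auto
    then show ?case
      using step1.IH[OF measurable_sets[OF eta_measurable step1.prems]] eta[OF step1.prems] by simp
  next
    case (step2 i)
    have "sh (i - 1) \<omega> = \<theta> (sh i \<omega>)" if "\<omega> \<in> space P" for \<omega>
      using sh_Suc[OF that, of "i - 1"] theta_eta[OF sh_in_space[OF that, of "i - 1"]] by simp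
    then have "sh (i - 1) -` A \<inter> space P = sh i -` (\<theta> -` A \<inter> space P) \<inter> space P"
      using sh_in_space by auto
    then show ?case
      using step2.IH[OF measurable_sets[OF theta_measurable step2.prems]] theta[OF step2.prems] by simp
  qed
qed

lemma env_shift: "\<omega> \<in> space P \<Longrightarrow> env (sh j \<omega>) i = env \<omega> (i + j)"
  by (simp add: environment_def sh_add)

text \<open>State \<open>i\<close> of the environment shifted by \<open>j\<close> is state
  \<open>i + j\<close> of the original one; positions differ by the constant \<open>j\<close>, which
  leaves limits unchanged.\<close>

lemma walk_shift:
  assumes "\<omega> \<in> space P"
  shows "walk T (env (sh j \<omega>)) i n x = walk T (env \<omega>) (i + j) n x - j"
  by (induction n) (simp_all add: walk_Suc env_shift[OF assms])

lemma up_shift: assumes "\<omega> \<in> space P" shows "up (env (sh j \<omega>)) i = up (env \<omega>) (i + j)"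
proof -
  have "(\<forall>Z. Q (Z + j)) \<longleftrightarrow> (\<forall>Z. Q Z)" for Q :: "int \<Rightarrow> bool" by (metis diff_add_cancel)
  from this[of "\<lambda>Z. \<forall>\<^sub>F n in sequentially. Z \<le> _ n"] show ?thesis
    by (simp add: up_def walk_shift[OF assms] filterlim_at_top le_diff_eq)
qed

section \<open>Joint measurability in the environment and the starting point\<close>

lemma space_step_borel: "space (step_borel \<beta> e G) = G"
  by (simp add: step_borel_def space_measure_of_conv)

lemma env_in_G: "\<omega> \<in> space P \<Longrightarrow> env \<omega> i \<in> G"
  using measurable_space[OF phi_measurable sh_in_space] by (simp add: environment_def space_step_borel)

lemma cell_const_env: "\<omega> \<in> space P \<Longrightarrow> cell_const (env \<omega>)"
  using G_const env_in_G unfolding cell_const_def by blast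

text \<open>In the metric case, functions of \<open>G\<close> at distance less than (1/2)^j agree on
  \<open>e j\<close>, so evaluation at a point of \<open>e j\<close> is locally constant.\<close>

lemma openin_evaluation:
  assumes x: "x \<in> space M"
  shows "openin (step_topology \<beta> e G) {g \<in> G. g x \<in> A}"
proof (cases "finite \<beta>")
  case True
  then show ?thesis by (simp add: step_topology_def)
next
  case False
  interpret S: Metric_space G "step_dist e" by (rule Metric_space_step_dist[OF False])
  obtain b where b: "b \<in> \<beta>" "x \<in> b" using cell_of_point[OF x] .
  then obtain j where j: "j \<ge> 1" "x \<in> e j" using enum[OF False] by (force simp: bij_betw_def)
  have close: "g x = h x" if "step_dist e g h < (1/2) ^ j" for g h
  proof (rule ccontr)
    assume ne: "g x \<noteq> h x"
    define B where "B = {n. \<forall>j\<in>{1..n}. \<forall>x\<in>e j. g x = h x}"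
    have "n < j" if "n \<in> B" for n
    proof (rule ccontr)
      assume "\<not> n < j"
      then have "j \<in> {1..n}" using j by simp
      then show False using that j ne unfolding B_def by blast
    qed
    then have "B \<subseteq> {..<j}" by blast
    then have "finite B" by (rule finite_subset) simp
    moreover have "0 \<in> B" by (simp add: B_def)
    ultimately have "Max B \<in> B" by (intro Max_in) auto
    then have "Max B \<le> j" using \<open>B \<subseteq> {..<j}\<close> by auto
    then have "(1/2::real) ^ j \<le> (1/2) ^ Max B" by (intro power_decreasing) auto
    moreover have "step_dist e g h = (1/2) ^ Max B"
      using ne by (auto simp: step_dist_def agreement_def B_def)
    ultimately show False using that by simp
  qed
  have "openin S.mtopology {g \<in> G. g x \<in> A}"
    unfolding S.openin_mtopology
  proof (intro conjI allI impI)
    fix g assume g: "g \<in> {g \<in> G. g x \<in> A}"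
    have "S.mball g ((1/2) ^ j) \<subseteq> {g \<in> G. g x \<in> A}"
    proof
      fix h assume "h \<in> S.mball g ((1/2) ^ j)"
      then have "h \<in> G" "g x = h x" using close[of g h] by simp_all
      then show "h \<in> {g \<in> G. g x \<in> A}" using g by simp
    qed
    then show "\<exists>r>0. S.mball g r \<subseteq> {g \<in> G. g x \<in> A}" by (intro exI[of _ "(1/2) ^ j"]) auto
  qed auto
  then show ?thesis using False by (simp add: step_topology_def)
qed

lemma evaluation_measurable:
  assumes x: "x \<in> space M"
  shows "(\<lambda>\<omega>. env \<omega> i x) \<in> P \<rightarrow>\<^sub>M count_space UNIV"
proof -
  have "(\<lambda>g. g x) \<in> step_borel \<beta> e G \<rightarrow>\<^sub>M count_space UNIV"
  proof (rule measurableI)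
    fix A :: "int set"
    have "(\<lambda>g. g x) -` A \<inter> G = {g \<in> G. g x \<in> A}" by auto
    moreover have "sets (step_borel \<beta> e G) = sigma_sets G {U. openin (step_topology \<beta> e G) U}"
      unfolding step_borel_def
    proof (rule sets_measure_of)
      have "openin (step_topology \<beta> e G) U \<Longrightarrow> U \<subseteq> G" for U
        unfolding step_topology_def
        using Metric_space.openin_mtopology[OF Metric_space_step_dist] by (auto split: if_splits)
      then show "{U. openin (step_topology \<beta> e G) U} \<subseteq> Pow G" by blast
    qed
    ultimately show "(\<lambda>g. g x) -` A \<inter> space (step_borel \<beta> e G) \<in> sets (step_borel \<beta> e G)"
      using openin_evaluation[OF x, of A] by (simp add: space_step_borel sigma_sets.Basic)
  qed simp
  then show ?thesis
    unfolding environment_def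
    by (rule measurable_compose[OF measurable_compose[OF sh_measurable phi_measurable]])
qed

text \<open>Jumps are constant on cells, so the preimage of a set of values is a countable union of
  rectangles, one for each cell; the \<omega>-side is read off at a sample point \<open>s b\<close>
  of the cell.\<close>

lemma env_pair_measurable:
  "(\<lambda>p. env (fst p) i (snd p)) \<in> P \<Otimes>\<^sub>M M \<rightarrow>\<^sub>M count_space UNIV"
proof (rule measurableI)
  fix A :: "int set"
  have "\<forall>b\<in>\<beta>. \<exists>x. x \<in> b" using cell_nonempty by blast
  then obtain s where s: "\<And>b. b \<in> \<beta> \<Longrightarrow> s b \<in> b" by metis
  define Q where "Q b = ((\<lambda>\<omega>. env \<omega> i (s b)) -` A \<inter> space P) \<times> b" for b
  have ss: "s b \<in> space M" if "b \<in> \<beta>" for b using s[OF that] cell_subset[OF that] by blast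
  have "Q b \<in> sets (P \<Otimes>\<^sub>M M)" if "b \<in> \<beta>" for b
    unfolding Q_def
    using measurable_sets[OF evaluation_measurable[OF ss[OF that], of i], of A] cell_sets[OF that]
    by (intro pair_measureI) auto
  then have "(\<Union>b\<in>\<beta>. Q b) \<in> sets (P \<Otimes>\<^sub>M M)"
    using countable_cells by (intro sets.countable_UN') auto
  moreover have "(\<lambda>p. env (fst p) i (snd p)) -` A \<inter> space (P \<Otimes>\<^sub>M M) = (\<Union>b\<in>\<beta>. Q b)"
  proof (intro set_eqI iffI)
    fix p assume "p \<in> (\<lambda>p. env (fst p) i (snd p)) -` A \<inter> space (P \<Otimes>\<^sub>M M)"
    then have p: "env (fst p) i (snd p) \<in> A" "fst p \<in> space P" "snd p \<in> space M"
      by (auto simp: space_pair_measure)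
    obtain b where b: "b \<in> \<beta>" "snd p \<in> b" using cell_of_point[OF p(3)] .
    then have "env (fst p) i (s b) = env (fst p) i (snd p)"
      using G_const[OF env_in_G[OF p(2)] b(1)] s by blast
    then have "p \<in> Q b" using p b by (cases p) (simp add: Q_def)
    then show "p \<in> (\<Union>b\<in>\<beta>. Q b)" using b by blast
  next
    fix p assume "p \<in> (\<Union>b\<in>\<beta>. Q b)"
    then obtain b where b: "b \<in> \<beta>" "p \<in> Q b" by blast
    then have p: "env (fst p) i (s b) \<in> A" "fst p \<in> space P" "snd p \<in> b" by (auto simp: Q_def)
    have "env (fst p) i (s b) = env (fst p) i (snd p)"
      using G_const[OF env_in_G[OF p(2)] b(1)] s[OF b(1)] p(3) by blast
    then show "p \<in> (\<lambda>p. env (fst p) i (snd p)) -` A \<inter> space (P \<Otimes>\<^sub>M M)"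
      using p cell_subset[OF b(1)] by (auto simp: space_pair_measure mem_Times_iff)
  qed
  ultimately show "(\<lambda>p. env (fst p) i (snd p)) -` A \<inter> space (P \<Otimes>\<^sub>M M) \<in> sets (P \<Otimes>\<^sub>M M)" by simp
qed simp

lemma walk_pair_measurable [measurable]:
  "(\<lambda>p. walk T (env (fst p)) i n (snd p)) \<in> P \<Otimes>\<^sub>M M \<rightarrow>\<^sub>M count_space UNIV"
proof (induction n)
  case (Suc n)
  have step: "(\<lambda>p. k + env (fst p) k ((T ^^ n) (snd p))) \<in> P \<Otimes>\<^sub>M M \<rightarrow>\<^sub>M count_space UNIV" for k
  proof -
    have "(\<lambda>p. (fst p, (T ^^ n) (snd p))) \<in> P \<Otimes>\<^sub>M M \<rightarrow>\<^sub>M P \<Otimes>\<^sub>M M"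
      using measurable_compose[OF measurable_snd T_power_measurable] by (intro measurable_Pair) auto
    from measurable_compose[OF this env_pair_measurable[of k]]
    have "(\<lambda>p. env (fst p) k ((T ^^ n) (snd p))) \<in> P \<Otimes>\<^sub>M M \<rightarrow>\<^sub>M count_space UNIV" by simp
    then show ?thesis by (rule measurable_compose) simp
  qed
  \<comment> \<open>The current state is a random index with countably many values; for each value
    \<open>k\<close> the new position is measurable by \<open>step\<close>.\<close>
  show ?case unfolding walk_Suc by (rule measurable_compose_countable[OF step Suc])
qed simp

lemma measure_section_measurable:
  assumes Q: "Q \<in> sets (P \<Otimes>\<^sub>M M)" and E: "\<And>\<omega>. \<omega> \<in> space P \<Longrightarrow> E \<omega> = {x \<in> space M. (\<omega>, x) \<in> Q}"
  shows "(\<lambda>\<omega>. measure M (E \<omega>)) \<in> borel_measurable P"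
proof -
  have "(\<lambda>\<omega>. enn2real (emeasure M (Pair \<omega> -` Q))) \<in> borel_measurable P"
    using measurable_emeasure_Pair[OF Q] by measurable
  moreover have "enn2real (emeasure M (Pair \<omega> -` Q)) = measure M (E \<omega>)" if "\<omega> \<in> space P" for \<omega>
  proof -
    have "Pair \<omega> -` Q = E \<omega>"
      using sets.sets_into_space[OF Q] E[OF that] by (auto simp: space_pair_measure)
    then show ?thesis by (simp add: measure_def)
  qed
  ultimately show ?thesis by (simp cong: measurable_cong)
qed

lemma measure_up_measurable [measurable]: "(\<lambda>\<omega>. measure M (up (env \<omega>) i)) \<in> borel_measurable P"
proof (rule measure_section_measurable)
  show "{p \<in> space (P \<Otimes>\<^sub>M M). \<forall>Z. \<exists>N. \<forall>n\<ge>N. Z \<le> walk T (env (fst p)) i n (snd p)} \<in> sets (P \<Otimes>\<^sub>M M)"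
    by measurable
qed (auto simp: up_def filterlim_at_top eventually_sequentially space_pair_measure)

lemma up_sets: "\<omega> \<in> space P \<Longrightarrow> up (env \<omega>) i \<in> sets M"
  using skew_invariant_sets[OF skew_invariant_up[OF cell_const_env]] .

lemma down_sets: "\<omega> \<in> space P \<Longrightarrow> down (env \<omega>) i \<in> sets M"
  using skew_invariant_sets[OF skew_invariant_down[OF cell_const_env]] .

section \<open>Zero-one law and recurrence of environments\<close>

lemma ergodic_zero_one:
  assumes erg: "ergodic_environment P \<eta>" and A: "{\<omega> \<in> space P. Q \<omega>} \<in> sets P"
    and inv: "\<And>\<omega>. \<omega> \<in> space P \<Longrightarrow> Q (\<eta> \<omega>) \<longleftrightarrow> Q \<omega>"
  shows "(AE \<omega> in P. \<not> Q \<omega>) \<or> (AE \<omega> in P. Q \<omega>)"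
proof -
  have "\<eta> -` {\<omega> \<in> space P. Q \<omega>} \<inter> space P = {\<omega> \<in> space P. Q \<omega>}"
    using inv measurable_space[OF eta_measurable] by auto
  then have "measure P {\<omega> \<in> space P. Q \<omega>} = 0 \<or> measure P {\<omega> \<in> space P. Q \<omega>} = 1"
    using erg A unfolding ergodic_environment_def by blast
  then show ?thesis
  proof
    assume "measure P {\<omega> \<in> space P. Q \<omega>} = 0"
    then have "{\<omega> \<in> space P. Q \<omega>} \<in> null_sets P"
      using A by (intro null_setsI) (simp_all add: P.emeasure_eq_measure)
    then have "AE \<omega> in P. \<omega> \<notin> {\<omega> \<in> space P. Q \<omega>}" by (rule AE_not_in)
    then have "AE \<omega> in P. \<not> Q \<omega>" by (rule AE_mp) auto
    then show ?thesis ..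
  next
    assume "measure P {\<omega> \<in> space P. Q \<omega>} = 1"
    then show ?thesis using P.AE_in_set_eq_1[OF A] by simp
  qed
qed

text \<open>Poincare recurrence along the backward orbit, upgraded to almost sure by ergodicity.\<close>
lemma backward_recurrence:
  assumes erg: "ergodic_environment P \<eta>" and st: "stationary_environment P \<eta>"
    and W: "W \<in> sets P" and pos: "measure P W > 0"
  shows "AE \<omega> in P. \<forall>N. \<exists>j\<ge>N. sh (- int j) \<omega> \<in> W"
proof -
  define V where "V N = {\<omega> \<in> space P. \<exists>j\<ge>N. sh (- int j) \<omega> \<in> W}" for N :: nat
  note [measurable] = W
  have VM: "V N \<in> sets P" for N unfolding V_def by measurable
  have eq: "(\<Inter>N. V N) = {\<omega> \<in> space P. \<forall>N. \<exists>j\<ge>N. sh (- int j) \<omega> \<in> W}" by (auto simp: V_def)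
  have "(\<Inter>N. V N) \<in> sets P" using VM by auto
  then have A: "{\<omega> \<in> space P. \<forall>N. \<exists>j\<ge>N. sh (- int j) \<omega> \<in> W} \<in> sets P" unfolding eq .
  \<comment> \<open>Replacing \<omega> by \<open>\<eta> \<omega>\<close> delays every visit by one,
    which does not affect the occurrence of infinitely many.\<close>
  have inv: "(\<forall>N. \<exists>j\<ge>N. sh (- int j) (\<eta> \<omega>) \<in> W) \<longleftrightarrow> (\<forall>N. \<exists>j\<ge>N. sh (- int j) \<omega> \<in> W)"
    if \<omega>: "\<omega> \<in> space P" for \<omega>
  proof -
    have s: "sh (- int (Suc j)) (\<eta> \<omega>) = sh (- int j) \<omega>" for j
      using sh_add[OF \<omega>, of "- int (Suc j)" 1] sh_1[OF \<omega>] by simp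
    show ?thesis
    proof (intro iffI allI)
      fix N assume "\<forall>N. \<exists>j\<ge>N. sh (- int j) (\<eta> \<omega>) \<in> W"
      then obtain j where j: "j \<ge> Suc N" "sh (- int j) (\<eta> \<omega>) \<in> W" by blast
      then obtain l where "j = Suc l" by (cases j) auto
      then show "\<exists>j\<ge>N. sh (- int j) \<omega> \<in> W" using j s[of l] by auto
    next
      fix N assume "\<forall>N. \<exists>j\<ge>N. sh (- int j) \<omega> \<in> W"
      then obtain j where "j \<ge> N" "sh (- int j) \<omega> \<in> W" by blast
      then show "\<exists>j\<ge>N. sh (- int j) (\<eta> \<omega>) \<in> W" using s[of j] by (intro exI[of _ "Suc j"]) simp
    qed
  qed
  \<comment> \<open>\<open>V N\<close> contains a preimage of \<open>W\<close> under a shift, of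
    equal measure by stationarity; hence the decreasing intersection has at least the measure of
    \<open>W\<close>.\<close>
  have "measure P W \<le> measure P (V N)" for N
  proof -
    have "sh (- int N) -` W \<inter> space P \<subseteq> V N" by (auto simp: V_def)
    then have "measure P (sh (- int N) -` W \<inter> space P) \<le> measure P (V N)"
      using VM by (intro P.finite_measure_mono)
    then show ?thesis by (simp add: measure_sh_vimage[OF st W])
  qed
  moreover have "(\<lambda>N. measure P (V N)) \<longlonglongrightarrow> measure P (\<Inter>N. V N)"
  proof (rule P.finite_Lim_measure_decseq)
    show "decseq V" unfolding decseq_def V_def by (blast intro: order_trans)
  qed (use VM in auto)
  ultimately have "measure P W \<le> measure P (\<Inter>N. V N)" by (intro LIMSEQ_le_const) auto
  then have ge: "0 < measure P {\<omega> \<in> space P. \<forall>N. \<exists>j\<ge>N. sh (- int j) \<omega> \<in> W}" using pos unfolding eq by linarith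
  have "\<not> (AE \<omega> in P. \<not> (\<forall>N. \<exists>j\<ge>N. sh (- int j) \<omega> \<in> W))"
  proof
    assume "AE \<omega> in P. \<not> (\<forall>N. \<exists>j\<ge>N. sh (- int j) \<omega> \<in> W)"
    then have "AE \<omega> in P. \<omega> \<in> {\<omega> \<in> space P. \<forall>N. \<exists>j\<ge>N. sh (- int j) \<omega> \<in> W} \<longrightarrow> \<omega> \<in> {}"
      by (rule AE_mp) auto
    then have "measure P {\<omega> \<in> space P. \<forall>N. \<exists>j\<ge>N. sh (- int j) \<omega> \<in> W} \<le> measure P {}"
      using A by (intro P.finite_measure_mono_AE) auto
    then show False using ge by simp
  qed
  then show ?thesis using ergodic_zero_one[OF erg A inv] by blast
qed

lemma env_bound:
  assumes "bounded_jumps"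
  obtains L where "L \<ge> 0" "\<And>\<omega>. \<omega> \<in> space P \<Longrightarrow> \<forall>i. \<forall>x\<in>space M. \<bar>env \<omega> i x\<bar> \<le> L"
proof -
  obtain J where J: "finite J" "\<And>g. g \<in> G \<Longrightarrow> g ` space M \<subseteq> J"
    using assms unfolding bounded_jumps_def by blast
  define L where "L = Max (insert 0 (abs ` J))"
  show thesis
  proof
    show "L \<ge> 0" using J(1) by (simp add: L_def)
    show "\<forall>i. \<forall>x\<in>space M. \<bar>env \<omega> i x\<bar> \<le> L" if "\<omega> \<in> space P" for \<omega>
    proof (intro allI ballI)
      fix i x assume "x \<in> space M"
      then have "env \<omega> i x \<in> J" using J(2)[OF env_in_G[OF that]] by blast
      then show "\<bar>env \<omega> i x\<bar> \<le> L" using J(1) unfolding L_def by (intro Max_ge) auto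
    qed
  qed
qed

lemma up_or_down_null:
  assumes lp: linkage_property and bj: bounded_jumps and erg: "ergodic_environment P \<eta>"
    and st: "stationary_environment P \<eta>"
  shows "(AE \<omega> in P. \<forall>i. measure M (up (env \<omega>) i) = 0) \<or>
    (AE \<omega> in P. \<forall>i. measure M (down (env \<omega>) i) = 0)"
proof -
  obtain r where r: "r > 0" and lnk: "AE \<omega> in P. linked M T \<beta> (env \<omega>) r"
    using lp unfolding linkage_property_def by blast
  obtain L where L: "L \<ge> 0" "\<And>\<omega>. \<omega> \<in> space P \<Longrightarrow> \<forall>i. \<forall>x\<in>space M. \<bar>env \<omega> i x\<bar> \<le> L"
    using env_bound[OF bj] by blast
  obtain \<delta> where \<delta>: "\<delta> > 0" "\<And>a. a \<in> \<beta> \<Longrightarrow> \<delta> \<le> measure M (T ` a)"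
    using image_measure_bound by blast
  \<comment> \<open>The radius is the jump bound \<open>L\<close>, so that the windows obtained
    cannot be jumped over; \<delta> / 2 is the precision that \<open>down_null\<close> asks
    for.\<close>
  obtain \<epsilon> where \<epsilon>: "\<epsilon> > 0" and tr: "\<And>f E i j. cell_const f \<Longrightarrow> linked M T \<beta> f r \<Longrightarrow> skew_invariant f E \<Longrightarrow>
      \<bar>i - j\<bar> \<le> L \<Longrightarrow> \<exists>a\<in>\<beta>. measure M (T ` a - E i) < \<epsilon> \<Longrightarrow> measure M (space M - E j) < \<delta> / 2"
  proof -
    have "\<delta> / 2 > 0" "int (nat L) = L" using \<delta> L by auto
    with transport[OF r, of "\<delta> / 2" "nat L"] that show thesis by metis
  qed
  \<comment> \<open>Passing from \<omega> to \<open>\<eta> \<omega>\<close> shifts the states by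
    one, so the existence of a state with \<open>up\<close> of positive measure is an invariant
    event.\<close>
  have "(AE \<omega> in P. \<not> (\<exists>i. measure M (up (env \<omega>) i) > 0)) \<or> (AE \<omega> in P. \<exists>i. measure M (up (env \<omega>) i) > 0)"
  proof (rule ergodic_zero_one[OF erg])
    show "{\<omega> \<in> space P. \<exists>i. measure M (up (env \<omega>) i) > 0} \<in> sets P" by measurable
    fix \<omega> assume \<omega>: "\<omega> \<in> space P"
    have "up (env (\<eta> \<omega>)) i = up (env \<omega>) (i + 1)" for i
      using up_shift[OF \<omega>, of 1] sh_1[OF \<omega>] by simp
    then show "(\<exists>i. measure M (up (env (\<eta> \<omega>)) i) > 0) \<longleftrightarrow> (\<exists>i. measure M (up (env \<omega>) i) > 0)"
      by (metis diff_add_cancel)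
  qed
  then show ?thesis
  proof
    assume "AE \<omega> in P. \<not> (\<exists>i. measure M (up (env \<omega>) i) > 0)"
    then have "AE \<omega> in P. \<forall>i. measure M (up (env \<omega>) i) = 0"
      by (rule AE_mp) (auto simp: zero_less_measure_iff)
    then show ?thesis ..
  next
    assume pos: "AE \<omega> in P. \<exists>i. measure M (up (env \<omega>) i) > 0"
    \<comment> \<open>Environments with a good window centred at 0; \<open>sh_W\<close> recentres it
      at \<open>j\<close>. Using the measure of \<open>up\<close> rather than of its complement
      reduces measurability to \<open>measure_up_measurable\<close>.\<close>
    define W where "W = {\<omega> \<in> space P. \<forall>k. \<bar>k\<bar> \<le> L \<longrightarrow> 1 - measure M (up (env \<omega>) k) < \<delta> / 2}"
    have WM: "W \<in> sets P" unfolding W_def by measurable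
    have sh_W: "sh j \<omega> \<in> W \<longleftrightarrow> (\<forall>k. \<bar>k - j\<bar> \<le> L \<longrightarrow> measure M (space M - up (env \<omega>) k) < \<delta> / 2)"
      if \<omega>: "\<omega> \<in> space P" for \<omega> j
    proof -
      have "sh j \<omega> \<in> W \<longleftrightarrow> (\<forall>k. \<bar>k\<bar> \<le> L \<longrightarrow> measure M (space M - up (env \<omega>) (k + j)) < \<delta> / 2)"
        using sh_in_space[OF \<omega>] prob_compl[OF up_sets[OF \<omega>]] by (simp add: W_def up_shift[OF \<omega>])
      also have "\<dots> \<longleftrightarrow> (\<forall>k. \<bar>k - j\<bar> \<le> L \<longrightarrow> measure M (space M - up (env \<omega>) k) < \<delta> / 2)"
        by (metis add_diff_cancel_right' diff_add_cancel)
      finally show ?thesis .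
    qed
    \<comment> \<open>A positive \<open>up\<close> nearly fills one image at some state
      \<open>j\<close>, and transport spreads this to the window around \<open>j\<close>.\<close>
    have ex: "AE \<omega> in P. \<exists>j. sh j \<omega> \<in> W"
      using pos lnk AE_space
    proof eventually_elim
      case (elim \<omega>)
      note f = cell_const_env[OF elim(3)]
      obtain i where "measure M (up (env \<omega>) i) > 0" using elim(1) by blast
      then obtain j where "\<exists>a\<in>\<beta>. measure M (T ` a - up (env \<omega>) j) < \<epsilon>"
        using up_image_large[OF f _ \<epsilon>] by blast
      then have "\<forall>k. \<bar>k - j\<bar> \<le> L \<longrightarrow> measure M (space M - up (env \<omega>) k) < \<delta> / 2"
        using tr[OF f elim(2) skew_invariant_up[OF f], of j] by (simp add: abs_minus_commute)
      then show ?case using sh_W[OF elim(3)] by blast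
    qed
    \<comment> \<open>If \<open>W\<close> were null, so would be its countably many shifts,
      contradicting \<open>ex\<close>.\<close>
    have "measure P W > 0"
    proof (rule ccontr)
      assume "\<not> measure P W > 0"
      then have "measure P W = 0" by (simp add: zero_less_measure_iff)
      have "AE \<omega> in P. sh j \<omega> \<notin> W" for j
      proof -
        have "sh j -` W \<inter> space P \<in> null_sets P"
          using measure_sh_vimage[OF st WM, of j] \<open>measure P W = 0\<close> measurable_sets[OF sh_measurable WM]
          by (intro null_setsI) (simp_all add: P.emeasure_eq_measure)
        then have "AE \<omega> in P. \<omega> \<notin> sh j -` W \<inter> space P" by (rule AE_not_in)
        then show ?thesis by (rule AE_mp) auto
      qed
      then have "AE \<omega> in P. \<forall>j. sh j \<omega> \<notin> W" by (simp add: AE_all_countable)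
      with ex have "AE \<omega> in P. False" by eventually_elim blast
      then show False by simp
    qed
    from backward_recurrence[OF erg st WM this]
    have "AE \<omega> in P. \<forall>i. measure M (down (env \<omega>) i) = 0"
      using AE_space
    proof eventually_elim
      case (elim \<omega>)
      have "\<exists>j\<le>N. \<forall>k. \<bar>k - j\<bar> \<le> L \<longrightarrow> measure M (space M - up (env \<omega>) k) < \<delta> / 2" for N
      proof -
        obtain j where "j \<ge> nat (- N)" "sh (- int j) \<omega> \<in> W" using elim(1) by blast
        then show ?thesis using sh_W[OF elim(2)] by (intro exI[of _ "- int j"]) auto
      qed
      then show ?case using down_null[OF cell_const_env[OF elim(2)] L(2)[OF elim(2)] \<delta>] by blast
    qed
    then show ?thesis ..
  qed
qed

lemma AE_AE_up_or_down:
  assumes lp: linkage_property and bj: bounded_jumps and tr: transient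
  shows "AE \<omega> in P. AE x in M. \<forall>i. x \<in> up (env \<omega>) i \<or> x \<in> down (env \<omega>) i"
proof -
  obtain r where r: "r > 0" and lnk: "AE \<omega> in P. linked M T \<beta> (env \<omega>) r"
    using lp unfolding linkage_property_def by blast
  obtain L where L: "L \<ge> 0" "\<And>\<omega>. \<omega> \<in> space P \<Longrightarrow> \<forall>i. \<forall>x\<in>space M. \<bar>env \<omega> i x\<bar> \<le> L"
    using env_bound[OF bj] by blast
  show ?thesis
    using lnk tr[unfolded transient_def] AE_space
  proof eventually_elim
    case (elim \<omega>)
    then show ?case
      unfolding AE_all_countable
      using AE_up_or_down[OF cell_const_env[OF elim(3)] elim(1) r L(2)[OF elim(3)]] by blast
  qed
qed

lemma AE_not_in_all:
  fixes A :: "int \<Rightarrow> 'a set"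
  assumes "\<And>i. A i \<in> sets M" "\<forall>i. measure M (A i) = 0"
  shows "AE x in M. \<forall>i. x \<notin> A i"
  unfolding AE_all_countable
proof
  fix i
  have "A i \<in> null_sets M" using assms by (intro null_setsI) (simp_all add: emeasure_eq_measure)
  then show "AE x in M. x \<notin> A i" by (rule AE_not_in)
qed

end

theorem theorem5p12:
  fixes M :: "'a measure" and T :: "'a \<Rightarrow> 'a" and \<beta> :: "'a set set" and e :: "nat \<Rightarrow> 'a set"
    and G :: "('a \<Rightarrow> int) set"
    and P :: "'w measure" and \<eta> :: "'w \<Rightarrow> 'w" and \<phi> :: "'w \<Rightarrow> 'a \<Rightarrow> int"
  assumes "dwde M T \<beta> e G P \<eta> \<phi>"
    and "dwde.linkage_property M T \<beta> P \<eta> \<phi>"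
    and "dwde.bounded_jumps M G"
    and "ergodic_environment P \<eta>"
    and "stationary_environment P \<eta>"
    and "dwde.transient M T P \<eta> \<phi>"
  shows
    "(AE \<omega> in P. AE x in M. \<forall>i. filterlim (\<lambda>n. dwde.U T P \<eta> \<phi> i n x \<omega>) at_top sequentially) \<or>
     (AE \<omega> in P. AE x in M. \<forall>i. filterlim (\<lambda>n. dwde.U T P \<eta> \<phi> i n x \<omega>) at_bot sequentially)"
proof -
  interpret dwde M T \<beta> e G P \<eta> \<phi> by (rule assms(1))
  note ud = AE_AE_up_or_down[OF assms(2,3,6)]
  \<comment> \<open>By \<open>ud\<close> almost every walk has one of the two limits, from all
    starting states at once; whichever of \<open>up\<close> and \<open>down\<close> is null at every
    state leaves the other limit.\<close>
  from up_or_down_null[OF assms(2-5)] show ?thesis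
  proof
    assume "AE \<omega> in P. \<forall>i. measure M (up (env \<omega>) i) = 0"
    with ud have "AE \<omega> in P. AE x in M. \<forall>i. filterlim (\<lambda>n. U i n x \<omega>) at_bot sequentially"
      using AE_space
    proof eventually_elim
      case (elim \<omega>)
      from elim(1) AE_not_in_all[OF up_sets[OF elim(3)] elim(2)] show ?case
        by eventually_elim (auto simp: down_def U_def)
    qed
    then show ?thesis ..
  next
    assume "AE \<omega> in P. \<forall>i. measure M (down (env \<omega>) i) = 0"
    with ud have "AE \<omega> in P. AE x in M. \<forall>i. filterlim (\<lambda>n. U i n x \<omega>) at_top sequentially"
      using AE_space
    proof eventually_elim
      case (elim \<omega>)
      from elim(1) AE_not_in_all[OF down_sets[OF elim(3)] elim(2)] show ?case
        by eventually_elim (auto simp: up_def U_def)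
    qed
    then show ?thesis ..
  qed
qed

end
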